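(* Let $n,n',d$ be positive integers and let $\mathcal{A}\subset M_{n,d}\times\{1,\ldots,n'\}$ be admissible (including the strengthened spanning condition). Let $V_{\mathcal{A}}$ be the Vandermonde polynomial associated to $\mathcal{A}$. Then there exists a constant $c>0$ such that $$\int|V_{\mathcal{A}}(x_1,\ldots,x_{\#\mathcal{A}})|\prod_{j=1}^{\#\mathcal{A}}|f_j(x_j)|\,dx_1\cdots dx_{\#\mathcal{A}}\ \ge\ c\prod_{j=1}^{\#\mathcal{A}}\|f_j\|_{L^p(\mathbb{R}^n)}$$ for any measurable functions $f_j$ on $\mathbb{R}^n$, where $p:=\frac{\#\mathcal{A}}{\#\mathcal{A}+|\mathcal{A}|}<1$ and the integral is over $(\mathbb{R}^n)^{\#\mathcal{A}}$.
   Context: A multiindex of length $n$ is an $n$-tuple of nonnegative integers; $t^\alpha:=\prod_j t_j^{\alpha_j}$. $M_{n,d}$ is the set of multiindices of length $n$ and degree (sum of entries) at most $d$. For $\mathcal{A}\subset M_{n,d}\times\{1,\ldots,n'\}$ let $\mathcal{A}_j:=\{\alpha:(\alpha,j)\in\mathcal{A}\}$. Dictionary order: $\alpha\le\beta$ iff $\alpha=\beta$ or the smallest index $i$ with $\alpha_i\ne\beta_i$ satisfies $\alpha_i<\beta_i$. $\mathcal{A}$ is admissible when: (1) there is an integer $\#\mathcal{A}$ such that every $\mathcal{A}_j$, $j=1,\ldots,n'$, has cardinality $\#\mathcal{A}$; (2) there is an integer $|\mathcal{A}|$ with $\sum_{j}\sum_{\alpha\in\mathcal{A}_j}\alpha=|\mathcal{A}|(1,\ldots,1)$;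 (3) (strengthened spanning) if $\alpha_{1,k}<\cdots<\alpha_{\#\mathcal{A},k}$ is the increasing enumeration of $\mathcal{A}_k$ in dictionary order and $\beta_j:=\sum_{k=1}^{n'}\alpha_{j,k}$ for $j=1,\ldots,\#\mathcal{A}$, then $\beta_1,\ldots,\beta_{\#\mathcal{A}}$ span $\mathbb{R}^n$; (4) $\mathbf{0}\in\mathcal{A}_j$ for every $j$. For $x=(x_1,\ldots,x_{\#\mathcal{A}})\in(\mathbb{R}^n)^{\#\mathcal{A}}$ and $k=1,\ldots,n'$, let $V_k(x)$ be the determinant of the $\#\mathcal{A}\times\#\mathcal{A}$ matrix with $(j,m)$-entry $x_j^{\alpha_m}$, where $\alpha_1,\ldots,\alpha_{\#\mathcal{A}}$ is an enumeration of $\mathcal{A}_k$ (the choice affects only the sign). Then $V_{\mathcal{A}}(x):=\prod_{k=1}^{n'}V_k(x)$. For $0<p<1$, $\|f\|_{L^p}:=(\int|f|^p)^{1/p}$; the convention $0\cdot\infty=0$ is used. *)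

theory Defs
  imports
    "HOL-Analysis.Analysis"
    "HOL-Library.Fun_Lexorder"
    "Jordan_Normal_Form.Determinant"
begin

no_notation vec_index (infixl "$" 100)

text \<open>
  The coordinates of \<open>real ^ 'n\<close> and the entries of a multiindex are indexed by a finite linearly
  ordered type \<open>'n\<close>, which stands for \<open>{1, ..., n}\<close> with \<open>n = CARD('n)\<close>. The dictionary order on
  multiindices is then the library relation \<^const>\<open>less_fun\<close>.
\<close>

type_synonym 'n multiindex = "'n \<Rightarrow> nat"

definition multiindices :: "nat \<Rightarrow> ('n::finite) multiindex set" where
  "multiindices d = {\<alpha>. (\<Sum>i\<in>UNIV. \<alpha> i) \<le> d}"

definition monomial :: "real ^ 'n \<Rightarrow> ('n::finite) multiindex \<Rightarrow> real" where
  "monomial t \<alpha> = (\<Prod>i\<in>UNIV. (t $ i) ^ \<alpha> i)"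

definition slice :: "('n multiindex \<times> nat) set \<Rightarrow> nat \<Rightarrow> 'n multiindex set" where
  "slice A k = {\<alpha>. (\<alpha>, k) \<in> A}"

definition dict_enum :: "('n::{finite,linorder}) multiindex set \<Rightarrow> 'n multiindex list" where
  "dict_enum S = (THE xs. sorted_wrt less_fun xs \<and> set xs = S)"

lemma dict_enum:
  fixes S :: "('n::{finite,linorder}) multiindex set"
  assumes "finite S"
  shows "sorted_wrt less_fun (dict_enum S)" "set (dict_enum S) = S" "length (dict_enum S) = card S"
proof -
  let ?le = "\<lambda>f g :: 'n multiindex. less_fun f g \<or> f = g"
  have "class.order ?le less_fun"
    by (rule order_less_fun)
  moreover have "class.linorder_axioms ?le"
    by unfold_locales (use less_fun_trichotomy in \<open>metis finite_code\<close>)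
  ultimately interpret dict: linorder ?le less_fun
    by (rule class.linorder.intro)
  have ex1: "\<exists>!xs. sorted_wrt less_fun xs \<and> set xs = S"
    by (rule dict.ex1_sorted_list_for_set_if_finite[OF assms])
  from theI'[OF ex1] show *: "sorted_wrt less_fun (dict_enum S)" "set (dict_enum S) = S"
    by (simp_all add: dict_enum_def)
  from * show "length (dict_enum S) = card S"
    by (metis dict.strict_sorted_iff distinct_card)
qed

text \<open>
  \<open>admissible n' A N w\<close> says that \<open>A\<close> is admissible with \<open>#A = N\<close> and \<open>|A| = w\<close>; both numbers are
  determined by \<open>A\<close> when \<open>n' > 0\<close>. The four conjuncts are constant cardinality, homogeneity, the
  strengthened spanning condition, and the presence of the zero multiindex.
  Enumerations are indexed by \<open>0, ..., N - 1\<close>.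
\<close>

definition admissible ::
  "nat \<Rightarrow> (('n::{finite,linorder}) multiindex \<times> nat) set \<Rightarrow> nat \<Rightarrow> nat \<Rightarrow> bool" where
  "admissible n' A N w \<longleftrightarrow>
     (\<forall>k\<in>{1..n'}. card (slice A k) = N) \<and>
     (\<forall>i. (\<Sum>k=1..n'. \<Sum>\<alpha>\<in>slice A k. \<alpha> i) = w) \<and>
     span ((\<lambda>j. \<chi> i. \<Sum>k=1..n'. real ((dict_enum (slice A k) ! j) i)) ` {..<N})
       = UNIV \<and>
     (\<forall>k\<in>{1..n'}. (\<lambda>i. 0) \<in> slice A k)"

definition vandermonde_factor ::
  "(('n::{finite,linorder}) multiindex \<times> nat) set \<Rightarrow> nat \<Rightarrow> nat \<Rightarrow> (nat \<Rightarrow> real ^ 'n::{finite,linorder}) \<Rightarrow> real" where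
  "vandermonde_factor A N k x =
     Determinant.det (Matrix.mat N N (\<lambda>(j, m). monomial (x j) (dict_enum (slice A k) ! m)))"

definition vandermonde ::
  "nat \<Rightarrow> (('n::{finite,linorder}) multiindex \<times> nat) set \<Rightarrow> nat \<Rightarrow> (nat \<Rightarrow> real ^ 'n::{finite,linorder}) \<Rightarrow> real" where
  "vandermonde n' A N x = (\<Prod>k=1..n'. vandermonde_factor A N k x)"

text \<open>The \<open>L\<^sup>p\<close> (quasi-)norm for \<open>0 < p\<close>, with value \<open>\<infinity>\<close> when \<open>\<bar>f\<bar>\<^sup>p\<close> is not integrable.\<close>

definition lp_norm :: "real \<Rightarrow> ('a::euclidean_space \<Rightarrow> complex) \<Rightarrow> ennreal" where
  "lp_norm p f =
     (let I = \<integral>\<^sup>+ t. ennreal (norm (f t) powr p) \<partial>lebesgue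
      in if I = \<infinity> then \<infinity> else ennreal (enn2real I powr (1 / p)))"

end

theory Submission
  imports Defs "Jordan_Normal_Form.Char_Poly"
begin

text \<open>
  A polynomial in one variable of degree \<open>a\<close> with leading coefficient \<open>c\<close> satisfies
  \<open>\<integral>\<^sub>E |q| \<ge> const |c| |E| ^ (a + 1)\<close>. Applied coordinate by coordinate in dictionary order, this
  bounds \<open>\<integral> |P| |f|\<close> from below by the leading coefficient of \<open>P\<close> times a functional \<open>\<Phi>(\<beta>, f)\<close> depending
  only on the leading exponent \<open>\<beta>\<close>. The leading exponents of the successive minors of the Vandermonde
  polynomial are \<open>\<beta> r\<close> for \<open>r < N\<close>, so for each permutation \<open>\<tau>\<close> the integral dominates
  \<open>\<Prod>r<N. \<Phi>(\<beta> r, f (\<tau> r))\<close>. Multiplying over the cyclic shifts reduces the claim to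
  \<open>\<parallel>f\<parallel> ^ N \<le> C * (\<Prod>r<N. \<Phi>(\<beta> r, f))\<close> for a single function. There homogeneity gives the exponent
  \<open>p\<close>, and the spanning condition makes the sum over dyadic levels converge geometrically.
\<close>

subsection \<open>Sublevel sets in one variable\<close>

text \<open>One permutation cannot suffice. Dilating coordinate i by a factor t multiplies
  \<Phi>(\<beta>, f) by about t^(\<beta> i + 1), but the norm of f by t^(1 + w/N), so a single
  \<Phi>(\<beta> r, f) controls the norm only if \<beta> r is constantly w/N, which never happens
  for \<beta> 0 = 0. The product over all r scales like the N-th power of the norm, because the
  \<beta> r sum to (w, ..., w). Cyclic shifts let every function meet every exponent exactly once,
  so this product becomes available for each function.

  Correct scaling still does not exclude a loss from infinitely many towers of comparable size. The
  logarithm of a tower weight is linear in the logarithms of the levels, with one linear form for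
  each r. Spanning, together with \<beta> 0 = 0, says that these forms jointly determine the levels.
  A tower on which all weights are nearly maximal is therefore confined to a bounded region of
  levels, and away from it the product of the weights decays exponentially.\<close>

lemma abs_poly_ge_prod_dist:
  fixes q :: "real poly"
  shows "\<exists>xs :: real list. length xs = degree q \<and>
    (\<forall>t. \<bar>lead_coeff q\<bar> * (\<Prod>x\<leftarrow>xs. \<bar>t - x\<bar>) \<le> \<bar>poly q t\<bar>)"
proof -
  let ?q = "map_poly complex_of_real q"
  obtain zs where zs: "length zs = degree ?q" "?q = Polynomial.smult (lead_coeff ?q) (\<Prod>z\<leftarrow>zs. [:-z, 1:])"
    using fundamental_theorem_algebra_factorized[of ?q] by metis
  have "\<bar>lead_coeff q\<bar> * (\<Prod>x\<leftarrow>map Re zs. \<bar>t - x\<bar>) \<le> \<bar>poly q t\<bar>" for t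
  proof -
    \<comment> \<open>Moving a complex root to its real part can only bring it closer to a real
      point \<open>t\<close>.\<close>
    have "(\<Prod>x\<leftarrow>map Re ws. \<bar>t - x\<bar>) \<le> norm (poly (\<Prod>z\<leftarrow>ws. [:-z, 1:]) (complex_of_real t))" for ws
    proof (induction ws)
      case (Cons z ws)
      have "\<bar>t - Re z\<bar> \<le> norm (complex_of_real t - z)"
        using abs_Re_le_cmod[of "complex_of_real t - z"] by simp
      then have "\<bar>t - Re z\<bar> * (\<Prod>x\<leftarrow>map Re ws. \<bar>t - x\<bar>)
        \<le> norm (complex_of_real t - z) * norm (poly (\<Prod>z\<leftarrow>ws. [:-z, 1:]) (complex_of_real t))"
        using Cons by (intro mult_mono) (auto intro!: prod_list_nonneg)
      then show ?case
        by (simp add: norm_mult[symmetric] algebra_simps)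
    qed simp
    then have "\<bar>lead_coeff q\<bar> * (\<Prod>x\<leftarrow>map Re zs. \<bar>t - x\<bar>)
      \<le> norm (lead_coeff ?q) * norm (poly (\<Prod>z\<leftarrow>zs. [:-z, 1:]) (complex_of_real t))"
      by (auto simp: coeff_map_poly degree_map_poly intro!: mult_mono prod_list_nonneg)
    also have "\<dots> = norm (poly ?q (complex_of_real t))"
      by (subst (3) zs(2)) (simp add: norm_mult)
    also have "\<dots> = \<bar>poly q t\<bar>"
      by (simp add: of_real_hom.poly_map_poly)
    finally show ?thesis .
  qed
  then show ?thesis
    using zs(1) by (intro exI[of _ "map Re zs"]) (auto simp: degree_map_poly)
qed

lemma emeasure_UN_intervals_le:
  fixes xs :: "real list"
  assumes "0 \<le> r"
  shows "emeasure lborel (\<Union>x\<in>set xs. {x - r..x + r}) \<le> ennreal (2 * r * length xs)"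
proof -
  have "emeasure lborel (\<Union>x\<in>set xs. {x - r..x + r}) \<le> (\<Sum>x\<in>set xs. emeasure lborel {x - r..x + r})"
    by (intro emeasure_subadditive_finite) auto
  also have "\<dots> = ennreal (2 * r * card (set xs))"
    using assms by (simp add: ennreal_mult' ennreal_of_nat_eq_real_of_nat mult_ac)
  also have "\<dots> \<le> ennreal (2 * r * length xs)"
    using assms card_length[of xs] by (intro ennreal_leI mult_left_mono) auto
  finally show ?thesis .
qed

text \<open>The value produced by the radius r = |E| / (4 (a + 1)): the intervals of radius r around
  \<open>a\<close> points cover at most half of E, and on the remaining half the polynomial is at
  least its leading coefficient times r^a.\<close>

definition sublevel_const :: "nat \<Rightarrow> real" where
  "sublevel_const a = (1 / (4 * (a + 1))) ^ a / 2"

lemma sublevel_const_pos: "sublevel_const a > 0"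
  by (simp add: sublevel_const_def)

text \<open>Remove from \<open>E\<close> the neighbourhoods \<open>U r\<close> of the real parts of
  the roots, with \<open>r\<close> proportional to the measure of \<open>E\<close>; what is left
  still has at least half the measure. If \<open>a\<close> exceeds the degree, the coefficient is 0
  and so is the left side.\<close>

lemma nn_integral_abs_poly_ge:
  fixes q :: "real poly"
  assumes deg: "degree q \<le> a" and E: "E \<in> sets borel"
  shows "ennreal (sublevel_const a * \<bar>coeff q a\<bar>) * emeasure lborel E ^ (a + 1)
    \<le> (\<integral>\<^sup>+t. ennreal \<bar>poly q t\<bar> * indicator E t \<partial>lborel)"
proof (cases "coeff q a = 0")
  case False
  with deg have a: "degree q = a"
    by (metis le_antisym le_degree)
  obtain xs :: "real list" where xs: "length xs = a"
    "\<And>t. \<bar>coeff q a\<bar> * (\<Prod>x\<leftarrow>xs. \<bar>t - x\<bar>) \<le> \<bar>poly q t\<bar>"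
    using abs_poly_ge_prod_dist[of q] a by blast
  define U where "U r = (\<Union>x\<in>set xs. {x - r..x + r})" for r :: real
  have U [measurable]: "U r \<in> sets borel" for r
    unfolding U_def by auto
  have Ule: "emeasure lborel (U r) \<le> ennreal (2 * r * a)" if "0 \<le> r" for r
    using emeasure_UN_intervals_le[OF that, of xs] unfolding U_def xs(1) .
  have key: "ennreal (\<bar>coeff q a\<bar> * r ^ a) * emeasure lborel (E - U r)
    \<le> (\<integral>\<^sup>+t. ennreal \<bar>poly q t\<bar> * indicator E t \<partial>lborel)" if "0 \<le> r" for r
  proof -
    have ge: "r ^ length ys \<le> (\<Prod>x\<leftarrow>ys. \<bar>t - x\<bar>)" if "\<forall>x\<in>set ys. r \<le> \<bar>t - x\<bar>" for ys t
      using that by (induction ys) (auto intro!: mult_mono prod_list_nonneg zero_le_power \<open>0 \<le> r\<close>)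
    have "ennreal (\<bar>coeff q a\<bar> * r ^ a) * emeasure lborel (E - U r)
      = (\<integral>\<^sup>+t. ennreal (\<bar>coeff q a\<bar> * r ^ a) * indicator (E - U r) t \<partial>lborel)"
      using E by (subst nn_integral_cmult_indicator) auto
    also have "\<dots> \<le> (\<integral>\<^sup>+t. ennreal \<bar>poly q t\<bar> * indicator E t \<partial>lborel)"
    proof (intro nn_integral_mono)
      fix t
      have "ennreal (\<bar>coeff q a\<bar> * r ^ a) \<le> ennreal \<bar>poly q t\<bar>" if "t \<in> E - U r"
      proof -
        have "\<forall>x\<in>set xs. r \<le> \<bar>t - x\<bar>"
          using that by (force simp: U_def abs_if)
        from ge[OF this] have "r ^ a \<le> (\<Prod>x\<leftarrow>xs. \<bar>t - x\<bar>)"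
          by (simp add: xs(1))
        then have "\<bar>coeff q a\<bar> * r ^ a \<le> \<bar>coeff q a\<bar> * (\<Prod>x\<leftarrow>xs. \<bar>t - x\<bar>)"
          by (intro mult_left_mono) auto
        with xs(2)[of t] show ?thesis
          by (intro ennreal_leI) linarith
      qed
      then show "ennreal (\<bar>coeff q a\<bar> * r ^ a) * indicator (E - U r) t \<le> ennreal \<bar>poly q t\<bar> * indicator E t"
        by (auto simp: indicator_def)
    qed
    finally show ?thesis .
  qed
  show ?thesis
  proof (cases "emeasure lborel E = \<infinity>")
    case True
    \<comment> \<open>With infinite measure any fixed radius works: \<open>U 1\<close> has finite
      measure, so \<open>E - U 1\<close> keeps infinite measure.\<close>
    have "emeasure lborel E \<le> emeasure lborel (E - U 1) + emeasure lborel (U 1)"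
      using E by (intro order_trans[OF emeasure_mono emeasure_subadditive]) auto
    moreover have "emeasure lborel (U 1) < \<infinity>"
      using Ule[of 1] by (auto intro: le_less_trans)
    ultimately have "emeasure lborel (E - U 1) = \<infinity>"
      using True by (auto simp: top_unique ennreal_add_eq_top)
    then show ?thesis
      using key[of 1] False by (auto simp: ennreal_mult_top top_unique)
  next
    case fin: False
    define s where "s = measure lborel E"
    have s: "emeasure lborel E = ennreal s" "0 \<le> s"
      using fin by (simp_all add: s_def emeasure_eq_ennreal_measure)
    define r where "r = s / (4 * (a + 1))"
    have r: "0 \<le> r" using s by (simp add: r_def)
    have "ennreal s \<le> emeasure lborel (E - U r) + emeasure lborel (U r)"
      unfolding s(1)[symmetric]
      using E by (intro order_trans[OF emeasure_mono emeasure_subadditive]) auto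
    also have "\<dots> \<le> emeasure lborel (E - U r) + ennreal (s / 2)"
    proof -
      have "2 * r * a \<le> s / 2"
        using s(2) by (simp add: r_def field_simps)
      then show ?thesis
        using Ule[OF r] by (intro add_left_mono) (meson ennreal_leI order_trans)
    qed
    finally have "ennreal s - ennreal (s / 2) \<le> emeasure lborel (E - U r)"
      by (metis add.commute ennreal_minus_le_iff ennreal_neq_top)
    then have half: "ennreal (s / 2) \<le> emeasure lborel (E - U r)"
      using s(2) by (subst (asm) ennreal_minus) auto
    have "ennreal (sublevel_const a * \<bar>coeff q a\<bar>) * emeasure lborel E ^ (a + 1)
      = ennreal (\<bar>coeff q a\<bar> * r ^ a) * ennreal (s / 2)"
      using s sublevel_const_pos[of a]
      by (simp add: ennreal_power ennreal_mult[symmetric] sublevel_const_def r_def power_divide less_imp_le field_simps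
        del: power_Suc)
        (simp add: field_simps)?
    also have "\<dots> \<le> ennreal (\<bar>coeff q a\<bar> * r ^ a) * emeasure lborel (E - U r)"
      by (intro mult_left_mono half) auto
    also note key[OF r]
    finally show ?thesis .
  qed
qed simp

text \<open>Degree bounds replace degrees because the top coefficient will be a polynomial in the
  remaining coordinates and may vanish at some of their values; the identity for the coefficient
  survives this.\<close>

lemma coeff_prod_at_degree_bounds:
  fixes q :: "'k \<Rightarrow> 'a::comm_semiring_1 poly"
  assumes "\<And>k. k \<in> K \<Longrightarrow> degree (q k) \<le> a k"
  shows "degree (prod q K) \<le> sum a K \<and> coeff (prod q K) (sum a K) = (\<Prod>k\<in>K. coeff (q k) (a k))"
  using assms
proof (induction K rule: infinite_finite_induct)
  case (insert k K)
  then have IH: "degree (prod q K) \<le> sum a K" "coeff (prod q K) (sum a K) = (\<Prod>k\<in>K. coeff (q k) (a k))"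
    and k: "degree (q k) \<le> a k" by auto
  have "coeff (q k * prod q K) (a k + sum a K) = (\<Sum>i\<le>a k + sum a K. if i = a k then coeff (q k) i * coeff (prod q K) (a k + sum a K - i) else 0)"
    unfolding coeff_mult
  proof (intro sum.cong refl)
    fix i
    assume "i \<in> {..a k + sum a K}"
    show "coeff (q k) i * coeff (prod q K) (a k + sum a K - i)
      = (if i = a k then coeff (q k) i * coeff (prod q K) (a k + sum a K - i) else 0)"
    proof (cases i "a k" rule: linorder_cases)
      case less
      then have "coeff (prod q K) (a k + sum a K - i) = 0"
        using IH(1) by (intro coeff_eq_0) auto
      with less show ?thesis by simp
    next
      case greater
      then have "coeff (q k) i = 0"
        using k by (intro coeff_eq_0) auto
      with greater show ?thesis by simp
    qed simp
  qed
  also have "\<dots> = coeff (q k) (a k) * coeff (prod q K) (sum a K)"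
    by (simp add: sum.delta)
  finally show ?case
    using insert(1,2) IH k degree_mult_le[of "q k" "prod q K"] by simp
qed simp_all

subsection \<open>Integrating out coordinates in dictionary order\<close>

definition pow2 :: "int \<Rightarrow> ennreal" where
  "pow2 k = ennreal (2 powr real_of_int k)"

text \<open>A tower is the set of points where \<open>h\<close> exceeds a dyadic level, the measure of its fibre in the
  first coordinate exceeds a second dyadic level, and so on through the list of coordinates. On it \<open>h\<close>
  behaves like the indicator of a box whose side lengths are the levels (the last one is
  \<open>tower_size\<close>), and \<open>tower_weight\<close> is the integral of \<open>\<psi>\<close> times the monomial of
  exponent \<open>\<beta>\<close> over such a box
  with a vertex at the origin, up to constants.\<close>

definition fiber_size :: "'i \<Rightarrow> int \<Rightarrow> (('i \<Rightarrow> real) \<Rightarrow> ennreal) \<Rightarrow> ('i \<Rightarrow> real) \<Rightarrow> ennreal" where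
  "fiber_size i k h z = emeasure lborel {t. pow2 k \<le> h (z(i := t))}"

text \<open>\<open>\<lambda>_. undefined\<close> is the only point of the product space over no
  coordinates, where the recursion ends.\<close>

fun tower_size :: "'i list \<Rightarrow> int list \<Rightarrow> (('i \<Rightarrow> real) \<Rightarrow> ennreal) \<Rightarrow> ennreal" where
  "tower_size (i # is) (k # ks) h = tower_size is ks (fiber_size i k h)"
| "tower_size _ _ h = h (\<lambda>_. undefined)"

text \<open>\<open>\<psi>\<close> is the transformation under which \<open>h\<close> enters the
  integrand. It is prescribed at the start; after coordinate \<open>i\<close> it is the power
  \<open>\<beta> i + 1\<close> that the one-variable estimate puts on the measure of the
  fibre.\<close>

fun tower_weight ::
  "('i \<Rightarrow> nat) \<Rightarrow> 'i list \<Rightarrow> int list \<Rightarrow> (ennreal \<Rightarrow> ennreal) \<Rightarrow> (('i \<Rightarrow> real) \<Rightarrow> ennreal) \<Rightarrow> ennreal" where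
  "tower_weight \<beta> (i # is) (k # ks) \<psi> h =
     \<psi> (pow2 k) * tower_weight \<beta> is ks (\<lambda>x. x ^ (\<beta> i + 1)) (fiber_size i k h)"
| "tower_weight \<beta> _ _ \<psi> h = \<psi> (h (\<lambda>_. undefined))"

abbreviation lborel_PiM :: "'i set \<Rightarrow> ('i \<Rightarrow> real) measure" where
  "lborel_PiM I \<equiv> Pi\<^sub>M I (\<lambda>_. lborel)"

lemma measurable_section:
  assumes "h \<in> borel_measurable (lborel_PiM (insert i I))" "z \<in> space (lborel_PiM I)"
  shows "(\<lambda>t. h (z(i := t))) \<in> borel_measurable borel"
proof -
  have "(\<lambda>t. z(i := t)) \<in> lborel \<rightarrow>\<^sub>M lborel_PiM (insert i I)"
    using assms(2) by measurable
  from measurable_compose[OF this assms(1)] show ?thesis by simp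
qed

lemma fiber_size_measurable:
  assumes "h \<in> borel_measurable (lborel_PiM (insert i I))"
  shows "fiber_size i k h \<in> borel_measurable (lborel_PiM I)"
proof -
  have "(\<lambda>(z, t). z(i := t)) \<in> lborel_PiM I \<Otimes>\<^sub>M lborel \<rightarrow>\<^sub>M lborel_PiM (insert i I)"
    by (rule measurable_add_dim)
  from measurable_compose[OF this assms]
  have m [measurable]: "(\<lambda>(z, t). h (z(i := t))) \<in> borel_measurable (lborel_PiM I \<Otimes>\<^sub>M lborel)"
    by (simp add: case_prod_beta')
  have "(\<lambda>z. \<integral>\<^sup>+t. indicator {x. pow2 k \<le> x} (h (z(i := t))) \<partial>lborel) \<in> borel_measurable (lborel_PiM I)"
    by (intro lborel.borel_measurable_nn_integral) measurable
  moreover have "(\<integral>\<^sup>+t. indicator {x. pow2 k \<le> x} (h (z(i := t))) \<partial>lborel) = fiber_size i k h z"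
    if "z \<in> space (lborel_PiM I)" for z
  proof -
    have [measurable]: "(\<lambda>t. h (z(i := t))) \<in> borel_measurable borel"
      using measurable_section[OF assms that] .
    have "(\<integral>\<^sup>+t. indicator {x. pow2 k \<le> x} (h (z(i := t))) \<partial>lborel)
      = (\<integral>\<^sup>+t. indicator {t. pow2 k \<le> h (z(i := t))} t \<partial>lborel)"
      by (intro nn_integral_cong) (auto simp: indicator_def)
    also have "\<dots> = fiber_size i k h z"
      unfolding fiber_size_def by (subst nn_integral_indicator) (auto, measurable)
    finally show ?thesis .
  qed
  ultimately show ?thesis
    by (subst (asm) measurable_cong) auto
qed

interpretation lborel_product: product_sigma_finite "\<lambda>_ :: 'i. lborel :: real measure"
  by standard

lemma nn_integral_lborel_PiM_insert:
  assumes "finite I" "i \<notin> I" "F \<in> borel_measurable (lborel_PiM (insert i I))"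
  shows "(\<integral>\<^sup>+z. F z \<partial>lborel_PiM (insert i I)) = (\<integral>\<^sup>+z. \<integral>\<^sup>+t. F (z(i := t)) \<partial>lborel \<partial>lborel_PiM I)"
  using lborel_product.product_nn_integral_insert[OF assms] .

text \<open>Polynomials are kept as indexed families of monomials, so that taking the top
  coefficient in one coordinate means restricting the index set and dropping that
  coordinate.\<close>

definition poly_in :: "'m set \<Rightarrow> ('m \<Rightarrow> real) \<Rightarrow> ('m \<Rightarrow> 'i \<Rightarrow> nat) \<Rightarrow> 'i set \<Rightarrow> ('i \<Rightarrow> real) \<Rightarrow> real" where
  "poly_in S c \<alpha> I z = (\<Sum>m\<in>S. c m * (\<Prod>i\<in>I. z i ^ \<alpha> m i))"

lemma poly_in_measurable:
  assumes "finite I" "I \<subseteq> J"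
  shows "poly_in S c \<alpha> I \<in> borel_measurable (lborel_PiM J)"
proof -
  have "(\<lambda>z. z i) \<in> borel_measurable (lborel_PiM J)" if "i \<in> I" for i
    using measurable_component_singleton[of i J "\<lambda>_. lborel"] that assms by auto
  then show ?thesis
    unfolding poly_in_def by (intro borel_measurable_sum borel_measurable_times borel_measurable_prod borel_measurable_power) auto
qed

text \<open>Induction on the coordinates: integrating out the most significant one leaves the coefficient of
  its top power, which only involves the monomials that agree with the leading one there.\<close>

lemma nn_integral_prod_poly_ge_tower:
  fixes "is" :: "'i::linorder list"
  assumes "sorted_wrt (<) is" "finite K" "\<And>k. k \<in> K \<Longrightarrow> finite (S k)"
    and "\<And>k m i. k \<in> K \<Longrightarrow> m \<in> S k \<Longrightarrow> i \<in> set is \<Longrightarrow>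
      (\<forall>i'\<in>set is. i' < i \<longrightarrow> \<alpha> k m i' = \<gamma> k i') \<Longrightarrow> \<alpha> k m i \<le> \<gamma> k i"
    and "h \<in> borel_measurable (lborel_PiM (set is))"
    and "mono \<psi>" "\<psi> \<in> borel_measurable borel"
    and "length ks = length is"
  shows "ennreal (\<Prod>i\<in>set is. sublevel_const (\<Sum>k\<in>K. \<gamma> k i)) *
      ennreal (\<Prod>k\<in>K. \<bar>\<Sum>m | m \<in> S k \<and> (\<forall>i\<in>set is. \<alpha> k m i = \<gamma> k i). c k m\<bar>) *
      tower_weight (\<lambda>i. \<Sum>k\<in>K. \<gamma> k i) is ks \<psi> h
    \<le> (\<integral>\<^sup>+z. ennreal (\<Prod>k\<in>K. \<bar>poly_in (S k) (c k) (\<alpha> k) (set is) z\<bar>) * \<psi> (h z) \<partial>lborel_PiM (set is))"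
  using assms
proof (induction "is" arbitrary: S h \<psi> ks)
  case Nil
  then show ?case
    by (simp add: poly_in_def PiM_empty nn_integral_count_space_finite)
next
  case (Cons i "is")
  define \<beta> where "\<beta> i = (\<Sum>k\<in>K. \<gamma> k i)" for i
  then have \<beta>: "\<beta> = (\<lambda>i. \<Sum>k\<in>K. \<gamma> k i)" by auto
  define S' where "S' k = {m \<in> S k. \<alpha> k m i = \<gamma> k i}" for k
  obtain k0 ks' where ks: "ks = k0 # ks'"
    using Cons.prems(8) by (cases ks) auto
  have sorted: "sorted_wrt (<) is" and less: "\<And>i'. i' \<in> set is \<Longrightarrow> i < i'"
    using Cons.prems(1) by auto
  then have i: "i \<notin> set is" by auto
  note fin = Cons.prems(2,3)
  have h: "h \<in> borel_measurable (lborel_PiM (insert i (set is)))"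
    using Cons.prems(5) by simp
  note \<psi> = Cons.prems(6,7)
  let ?I = "set is"
  let ?h = "fiber_size i k0 h"
  let ?P = "\<lambda>z. \<Prod>k\<in>K. \<bar>poly_in (S k) (c k) (\<alpha> k) (insert i ?I) z\<bar>"
  let ?P' = "\<lambda>z. \<Prod>k\<in>K. \<bar>poly_in (S' k) (c k) (\<alpha> k) ?I z\<bar>"
  have IH: "ennreal (\<Prod>i\<in>?I. sublevel_const (\<beta> i)) *
      ennreal (\<Prod>k\<in>K. \<bar>\<Sum>m | m \<in> S' k \<and> (\<forall>i\<in>?I. \<alpha> k m i = \<gamma> k i). c k m\<bar>) *
      tower_weight \<beta> is ks' (\<lambda>x. x ^ (\<beta> i + 1)) ?h
    \<le> (\<integral>\<^sup>+z. ennreal (?P' z) * ?h z ^ (\<beta> i + 1) \<partial>lborel_PiM ?I)"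
    unfolding \<beta>_def
  proof (rule Cons.IH[OF sorted fin(1)])
    fix k m j
    assume "k \<in> K" "m \<in> S' k" "j \<in> ?I" "\<forall>i'\<in>?I. i' < j \<longrightarrow> \<alpha> k m i' = \<gamma> k i'"
    then show "\<alpha> k m j \<le> \<gamma> k j"
      by (intro Cons.prems(4)) (auto simp: S'_def)
  next
    show "?h \<in> borel_measurable (lborel_PiM ?I)"
      using h by (rule fiber_size_measurable)
    show "mono (\<lambda>x::ennreal. x ^ (sum (\<lambda>k. \<gamma> k i) K + 1))"
      by (intro monoI power_mono) auto
  qed (use fin(2) Cons.prems(8) in \<open>auto simp: S'_def ks\<close>)
  have lead: "{m \<in> S' k. \<forall>i\<in>?I. \<alpha> k m i = \<gamma> k i} = {m \<in> S k. \<forall>i\<in>set (i # is). \<alpha> k m i = \<gamma> k i}" for k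
    by (auto simp: S'_def)
  have inner: "\<psi> (pow2 k0) * ennreal (sublevel_const (\<beta> i)) * (ennreal (?P' z) * ?h z ^ (\<beta> i + 1))
    \<le> (\<integral>\<^sup>+t. ennreal (?P (z(i := t))) * \<psi> (h (z(i := t))) \<partial>lborel)"
    if z: "z \<in> space (lborel_PiM ?I)" for z
  proof -
    define q where "q k = (\<Sum>m\<in>S k. monom (c k m * (\<Prod>i\<in>?I. z i ^ \<alpha> k m i)) (\<alpha> k m i))" for k
    \<comment> \<open>The one-variable estimate is applied on this superlevel set. There
      \<open>\<psi> (h ...)\<close> is at least \<open>\<psi> (pow2 k0)\<close> by monotonicity, and
      the measure of \<open>E\<close> is \<open>?h z\<close>, which is the function passed on to the
      remaining coordinates.\<close>
    define E where "E = {t. pow2 k0 \<le> h (z(i := t))}"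
    have sec [measurable]: "(\<lambda>t. h (z(i := t))) \<in> borel_measurable borel"
      using measurable_section[OF h z] .
    have E: "E \<in> sets borel"
      unfolding E_def by measurable
    have q_eval: "poly (q k) t = poly_in (S k) (c k) (\<alpha> k) (insert i ?I) (z(i := t))" for k t
    proof -
      have "(\<Prod>j\<in>?I. (z(i := t)) j ^ \<alpha> k m j) = (\<Prod>j\<in>?I. z j ^ \<alpha> k m j)" for m
        using i by (intro prod.cong) auto
      then show ?thesis
        using i by (simp add: q_def poly_in_def poly_sum poly_monom mult_ac del: fun_upd_apply)
          (simp add: mult_ac)
    qed
    have q_deg: "degree (q k) \<le> \<gamma> k i" if "k \<in> K" for k
      unfolding q_def
    proof (intro degree_sum_le fin(2) that)
      fix m assume "m \<in> S k"
      then have "\<alpha> k m i \<le> \<gamma> k i"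
        using less by (intro Cons.prems(4) that) (auto dest: less_asym)
      then show "degree (monom (c k m * (\<Prod>i\<in>?I. z i ^ \<alpha> k m i)) (\<alpha> k m i)) \<le> \<gamma> k i"
        using degree_monom_le order_trans by blast
    qed
    have q_coeff: "coeff (q k) (\<gamma> k i) = poly_in (S' k) (c k) (\<alpha> k) ?I z" if "k \<in> K" for k
      using fin(2)[OF that]
      by (simp add: q_def coeff_sum coeff_monom poly_in_def S'_def sum.If_cases Int_def cong: if_cong)
    have P_eq: "?P (z(i := t)) = \<bar>poly (prod q K) t\<bar>" for t
      by (simp add: poly_prod q_eval abs_prod)
    have qm: "(\<lambda>t. \<bar>poly (prod q K) t\<bar>) \<in> borel_measurable borel"
      by (intro borel_measurable_continuous_onI continuous_intros)
    have "ennreal (sublevel_const (\<beta> i)) * (ennreal (?P' z) * ?h z ^ (\<beta> i + 1))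
      = ennreal (sublevel_const (\<beta> i) * \<bar>coeff (prod q K) (\<beta> i)\<bar>) * emeasure lborel E ^ (\<beta> i + 1)"
      using coeff_prod_at_degree_bounds[of K q "\<lambda>k. \<gamma> k i", OF q_deg] q_coeff sublevel_const_pos[of "\<beta> i"]
      by (simp add: \<beta>_def abs_prod ennreal_mult less_imp_le fiber_size_def E_def mult_ac prod_nonneg cong: prod.cong)
    also have "\<dots> \<le> (\<integral>\<^sup>+t. ennreal \<bar>poly (prod q K) t\<bar> * indicator E t \<partial>lborel)"
      using coeff_prod_at_degree_bounds[of K q "\<lambda>k. \<gamma> k i", OF q_deg]
      by (intro nn_integral_abs_poly_ge E) (simp add: \<beta>_def)
    also have "\<dots> = (\<integral>\<^sup>+t. ennreal (?P (z(i := t))) * indicator E t \<partial>lborel)"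
      by (simp only: P_eq)
    finally have "\<psi> (pow2 k0) * (ennreal (sublevel_const (\<beta> i)) * (ennreal (?P' z) * ?h z ^ (\<beta> i + 1)))
      \<le> \<psi> (pow2 k0) * (\<integral>\<^sup>+t. ennreal (?P (z(i := t))) * indicator E t \<partial>lborel)"
      by (rule mult_left_mono) simp
    also have "\<dots> = (\<integral>\<^sup>+t. \<psi> (pow2 k0) * (ennreal (?P (z(i := t))) * indicator E t) \<partial>lborel)"
      using E by (intro nn_integral_cmult[symmetric]) (use qm in \<open>simp add: P_eq\<close>)
    also have "\<dots> \<le> (\<integral>\<^sup>+t. ennreal (?P (z(i := t))) * \<psi> (h (z(i := t))) \<partial>lborel)"
    proof (intro nn_integral_mono)
      fix t
      have "\<psi> (pow2 k0) \<le> \<psi> (h (z(i := t)))" if "t \<in> E"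
        using that \<psi>(1) by (auto simp: E_def dest: monoD)
      then show "\<psi> (pow2 k0) * (ennreal (?P (z(i := t))) * indicator E t) \<le> ennreal (?P (z(i := t))) * \<psi> (h (z(i := t)))"
        by (cases "t \<in> E") (simp_all add: mult.commute[of "\<psi> _"] mult_left_mono)
    qed
    finally show ?thesis by (simp only: mult.assoc)
  qed
  have Pm: "?P \<in> borel_measurable (lborel_PiM (insert i ?I))"
    using poly_in_measurable[of "insert i ?I" "insert i ?I"]
    by (intro borel_measurable_prod borel_measurable_abs) auto
  have P'm: "?P' \<in> borel_measurable (lborel_PiM ?I)"
    using poly_in_measurable[of ?I ?I]
    by (intro borel_measurable_prod borel_measurable_abs) auto
  note hm [measurable] = fiber_size_measurable[OF h]
  have "ennreal (\<Prod>i\<in>set (i # is). sublevel_const (\<beta> i)) *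
      ennreal (\<Prod>k\<in>K. \<bar>\<Sum>m | m \<in> S k \<and> (\<forall>i\<in>set (i # is). \<alpha> k m i = \<gamma> k i). c k m\<bar>) *
      tower_weight \<beta> (i # is) ks \<psi> h
    = \<psi> (pow2 k0) * ennreal (sublevel_const (\<beta> i)) * (ennreal (\<Prod>i\<in>?I. sublevel_const (\<beta> i)) *
      ennreal (\<Prod>k\<in>K. \<bar>\<Sum>m | m \<in> S' k \<and> (\<forall>i\<in>?I. \<alpha> k m i = \<gamma> k i). c k m\<bar>) *
      tower_weight \<beta> is ks' (\<lambda>x. x ^ (\<beta> i + 1)) ?h)"
    unfolding lead using i sublevel_const_pos
    by (simp add: ks ennreal_mult less_imp_le prod_nonneg mult_ac)
  also have "\<dots> \<le> \<psi> (pow2 k0) * ennreal (sublevel_const (\<beta> i)) *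
      (\<integral>\<^sup>+z. ennreal (?P' z) * ?h z ^ (\<beta> i + 1) \<partial>lborel_PiM ?I)"
    by (intro mult_left_mono IH) simp
  also have "\<dots> = (\<integral>\<^sup>+z. \<psi> (pow2 k0) * ennreal (sublevel_const (\<beta> i)) * (ennreal (?P' z) * ?h z ^ (\<beta> i + 1)) \<partial>lborel_PiM ?I)"
    using P'm hm
    by (intro nn_integral_cmult[symmetric] borel_measurable_times_ennreal borel_measurable_power_ennreal
      measurable_compose[OF P'm measurable_ennreal]) 
  also have "\<dots> \<le> (\<integral>\<^sup>+z. \<integral>\<^sup>+t. ennreal (?P (z(i := t))) * \<psi> (h (z(i := t))) \<partial>lborel \<partial>lborel_PiM ?I)"
    by (intro nn_integral_mono inner)
  also have "\<dots> = (\<integral>\<^sup>+z. ennreal (?P z) * \<psi> (h z) \<partial>lborel_PiM (insert i ?I))"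
    using Pm measurable_compose[OF h \<psi>(2)] i
    by (intro nn_integral_lborel_PiM_insert[symmetric]) auto
  also have "insert i ?I = set (i # is)" by simp
  finally show ?case
    unfolding \<beta> .
qed

subsection \<open>Summation over dyadic towers\<close>

lemma pow2_add: "pow2 (k + l) = pow2 k * pow2 l"
  by (simp add: pow2_def powr_add ennreal_mult)

lemma pow2_neg [simp]: "pow2 (- k) * pow2 k = 1" "pow2 k * pow2 (- k) = 1"
  by (simp_all add: pow2_add[symmetric]) (simp_all add: pow2_def)

lemma pow2_pos [simp]: "pow2 k > 0" "pow2 k \<noteq> 0"
  by (simp_all add: pow2_def)

lemma pow2_power_pos: "pow2 k ^ m > 0"
  by (simp add: pow2_def ennreal_power)

lemma pow2_one: "pow2 1 = 2"
  by (simp add: pow2_def)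

text \<open>For finite positive \<open>x\<close> the single term at k = floor (log2 x) already
  dominates; an infinite \<open>x\<close> lies above every level, so the terms are
  unbounded.\<close>

lemma ennreal_le_dyadic_sum:
  "x \<le> (\<integral>\<^sup>+k. pow2 (k + 1) * indicator {pow2 k..} x \<partial>count_space UNIV)" (is "x \<le> ?S")
proof (cases x)
  case (real r)
  show ?thesis
  proof (cases "r = 0")
    case False
    with real have r: "r > 0" by simp
    define k where "k = \<lfloor>log 2 r\<rfloor>"
    have "2 powr k \<le> 2 powr log 2 r" "2 powr log 2 r \<le> 2 powr (k + 1)"
      unfolding k_def by (intro powr_mono; linarith)+
    then have "2 powr k \<le> r" "r \<le> 2 powr (k + 1)"
      using r by auto
    then have "x \<le> pow2 (k + 1) * indicator {pow2 k..} x"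
      using real by (auto simp: pow2_def)
    also have "\<dots> \<le> ?S"
      by (intro nn_integral_ge_point) simp
    finally show ?thesis .
  qed (use real in simp)
next
  case top
  have "ennreal (real m) \<le> ?S" for m
  proof -
    have "real m \<le> 2 powr real m"
      using of_nat_less_two_power[of m, where 'a = real] by (simp add: powr_realpow)
    also have "\<dots> \<le> 2 powr (int m + 1)"
      by (intro powr_mono) auto
    finally have "ennreal (real m) \<le> pow2 (int m + 1) * indicator {pow2 (int m)..} x"
      using top by (auto simp: pow2_def intro!: ennreal_leI)
    also have "\<dots> \<le> ?S"
      by (intro nn_integral_ge_point) simp
    finally show ?thesis .
  qed
  then have "?S = \<infinity>"
    by (metis ennreal_of_nat_eq_real_of_nat ennreal_Ex_less_of_nat infinity_ennreal_def less_top not_le)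
  then show ?thesis by simp
qed

text \<open>A layer-cake decomposition in one coordinate after another. Rounding a level up to the
  next power of two costs the factor 2. In the induction the first level \<open>k\<close> is fixed
  and its share is absorbed into the constant, which becomes \<open>B * w 0 k * pow2 (- k)\<close>;
  summing over \<open>k\<close> afterwards restores the factor belonging to
  \<open>w 0\<close>.\<close>

lemma nn_integral_le_of_tower_bound:
  assumes "distinct is" "h \<in> borel_measurable (lborel_PiM (set is))"
    and "\<And>ks. length ks = length is \<Longrightarrow>
      (\<Prod>r<length is. pow2 (ks ! r)) * tower_size is ks h \<le> B * (\<Prod>r<length is. w r (ks ! r))"
  shows "(\<integral>\<^sup>+z. h z \<partial>lborel_PiM (set is))
    \<le> B * (\<Prod>r<length is. 2 * (\<integral>\<^sup>+k. w r k \<partial>count_space UNIV))"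
  using assms
proof (induction "is" arbitrary: h B w)
  case Nil
  from Nil(3)[of "[]"] show ?case
    by (simp add: PiM_empty nn_integral_count_space_finite)
next
  case (Cons i "is")
  let ?I = "set is"
  let ?R = "\<Prod>r<length is. 2 * (\<integral>\<^sup>+k. w (Suc r) k \<partial>count_space UNIV)"
  have i: "i \<notin> ?I" "distinct is" using Cons.prems(1) by auto
  have h: "h \<in> borel_measurable (lborel_PiM (insert i ?I))"
    using Cons.prems(2) by simp
  note hm = fiber_size_measurable[OF h]
  have fib: "(\<integral>\<^sup>+z. fiber_size i k h z \<partial>lborel_PiM ?I) \<le> (B * w 0 k * pow2 (- k)) * ?R" for k
  proof (rule Cons.IH[OF i(2) hm])
    fix ks :: "int list"
    assume len: "length ks = length is"
    let ?p = "\<Prod>r<length is. pow2 (ks ! r)" and ?w = "\<Prod>r<length is. w (Suc r) (ks ! r)"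
    let ?T = "tower_size is ks (fiber_size i k h)"
    have "pow2 k * (?p * ?T) \<le> B * (w 0 k * ?w)"
      using Cons.prems(3)[of "k # ks"] len by (simp add: prod.lessThan_Suc_shift mult_ac del: prod.lessThan_Suc)
    then have "pow2 (- k) * (pow2 k * (?p * ?T)) \<le> pow2 (- k) * (B * (w 0 k * ?w))"
      by (rule mult_left_mono) simp
    then show "?p * ?T \<le> B * w 0 k * pow2 (- k) * ?w"
      by (simp add: mult.assoc[symmetric]) (simp add: mult_ac)
  qed
  have "(\<integral>\<^sup>+z. h z \<partial>lborel_PiM (set (i # is))) = (\<integral>\<^sup>+z. \<integral>\<^sup>+t. h (z(i := t)) \<partial>lborel \<partial>lborel_PiM ?I)"
    using nn_integral_lborel_PiM_insert[OF _ i(1) h] by simp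
  also have "\<dots> \<le> (\<integral>\<^sup>+z. \<integral>\<^sup>+k. pow2 (k + 1) * fiber_size i k h z \<partial>count_space UNIV \<partial>lborel_PiM ?I)"
  proof (intro nn_integral_mono)
    fix z assume z: "z \<in> space (lborel_PiM ?I)"
    have [measurable]: "(\<lambda>t. h (z(i := t))) \<in> borel_measurable borel"
      using measurable_section[OF h z] .
    have "(\<integral>\<^sup>+t. h (z(i := t)) \<partial>lborel)
      \<le> (\<integral>\<^sup>+t. \<integral>\<^sup>+k. pow2 (k + 1) * indicator {pow2 k..} (h (z(i := t))) \<partial>count_space UNIV \<partial>lborel)"
      by (intro nn_integral_mono ennreal_le_dyadic_sum)
    also have "\<dots> = (\<integral>\<^sup>+k. \<integral>\<^sup>+t. pow2 (k + 1) * indicator {pow2 k..} (h (z(i := t))) \<partial>lborel \<partial>count_space UNIV)"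
      by (intro nn_integral_count_space_nn_integral) auto
    also have "\<dots> = (\<integral>\<^sup>+k. pow2 (k + 1) * fiber_size i k h z \<partial>count_space UNIV)"
    proof (intro nn_integral_cong)
      fix k :: int
      have "(\<integral>\<^sup>+t. pow2 (k + 1) * indicator {pow2 k..} (h (z(i := t))) \<partial>lborel)
        = (\<integral>\<^sup>+t. pow2 (k + 1) * indicator {t. pow2 k \<le> h (z(i := t))} t \<partial>lborel)"
        by (intro nn_integral_cong) (auto simp: indicator_def)
      also have "\<dots> = pow2 (k + 1) * fiber_size i k h z"
        unfolding fiber_size_def by (intro nn_integral_cmult_indicator) measurable
      finally show "(\<integral>\<^sup>+t. pow2 (k + 1) * indicator {pow2 k..} (h (z(i := t))) \<partial>lborel)
        = pow2 (k + 1) * fiber_size i k h z" .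
    qed
    finally show "(\<integral>\<^sup>+t. h (z(i := t)) \<partial>lborel)
      \<le> (\<integral>\<^sup>+k. pow2 (k + 1) * fiber_size i k h z \<partial>count_space UNIV)" .
  qed
  also have "\<dots> = (\<integral>\<^sup>+k. \<integral>\<^sup>+z. pow2 (k + 1) * fiber_size i k h z \<partial>lborel_PiM ?I \<partial>count_space UNIV)"
    using hm by (intro nn_integral_count_space_nn_integral) auto
  also have "\<dots> = (\<integral>\<^sup>+k. pow2 (k + 1) * (\<integral>\<^sup>+z. fiber_size i k h z \<partial>lborel_PiM ?I) \<partial>count_space UNIV)"
    using hm by (intro nn_integral_cong nn_integral_cmult)
  also have "\<dots> \<le> (\<integral>\<^sup>+k. B * 2 * ?R * w 0 k \<partial>count_space UNIV)"
  proof (intro nn_integral_mono)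
    fix k
    have "pow2 (k + 1) * (\<integral>\<^sup>+z. fiber_size i k h z \<partial>lborel_PiM ?I)
      \<le> pow2 (k + 1) * (B * w 0 k * pow2 (- k) * ?R)"
      by (intro mult_left_mono fib) simp
    also have "\<dots> = (pow2 k * pow2 (- k)) * (B * 2 * ?R * w 0 k)"
      unfolding pow2_add pow2_one by (simp only: mult_ac)
    finally show "pow2 (k + 1) * (\<integral>\<^sup>+z. fiber_size i k h z \<partial>lborel_PiM ?I) \<le> B * 2 * ?R * w 0 k"
      by simp
  qed
  also have "\<dots> = B * (\<Prod>r<length (i # is). 2 * (\<integral>\<^sup>+k. w r k \<partial>count_space UNIV))"
    by (subst nn_integral_cmult) (simp_all add: prod.lessThan_Suc_shift mult_ac del: prod.lessThan_Suc)
  finally show ?case .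
qed

text \<open>The binary logarithm of a tower weight; the list collects the logarithms of the levels and of the
  final size.\<close>

fun tower_exponent :: "('i \<Rightarrow> nat) \<Rightarrow> 'i list \<Rightarrow> real list \<Rightarrow> real \<Rightarrow> real" where
  "tower_exponent \<beta> (i # is) (x # xs) \<sigma> = \<sigma> * x + tower_exponent \<beta> is xs (real (\<beta> i) + 1)"
| "tower_exponent \<beta> [] (x # xs) \<sigma> = \<sigma> * x"
| "tower_exponent \<beta> _ [] \<sigma> = 0"

text \<open>Linearity in \<open>X\<close> is what the comparison of two towers uses. Entry 0 is the
  logarithmic level of the function itself and carries \<sigma>; entry \<open>Suc r\<close> measures
  the fibre in coordinate \<open>is ! r\<close> and carries the exponent of that coordinate plus
  one. There is thus one entry more than there are coordinates.\<close>

definition tower_form :: "('i \<Rightarrow> nat) \<Rightarrow> 'i list \<Rightarrow> real \<Rightarrow> (nat \<Rightarrow> real) \<Rightarrow> real" where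
  "tower_form \<beta> is \<sigma> X = \<sigma> * X 0 + (\<Sum>r<length is. (real (\<beta> (is ! r)) + 1) * X (Suc r))"

lemma tower_exponent_eq_form:
  "length xs = Suc (length is) \<Longrightarrow> tower_exponent \<beta> is xs \<sigma> = tower_form \<beta> is \<sigma> ((!) xs)"
proof (induction \<beta> "is" xs \<sigma> rule: tower_exponent.induct)
  case (1 \<beta> i "is" x xs \<sigma>)
  then show ?case
    by (simp add: tower_form_def sum.lessThan_Suc_shift del: sum.lessThan_Suc)
qed (auto simp: tower_form_def)

lemma tower_weight_eq_powr:
  assumes "length ks = length is" "tower_size is ks h = ennreal (2 powr y)"
    and "\<And>x. \<psi> (ennreal (2 powr x)) = ennreal (2 powr (\<sigma> * x))"
  shows "tower_weight \<beta> is ks \<psi> h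
    = ennreal (2 powr tower_form \<beta> is \<sigma> ((!) (map real_of_int ks @ [y])))"
proof -
  have "tower_weight \<beta> is ks \<psi> h
    = ennreal (2 powr tower_exponent \<beta> is (map real_of_int ks @ [y]) \<sigma>)"
    using assms
  proof (induction "is" ks h arbitrary: \<psi> \<sigma> rule: tower_size.induct)
    case (1 i "is" k ks h)
    have pw: "ennreal (2 powr x) ^ (\<beta> i + 1) = ennreal (2 powr ((real (\<beta> i) + 1) * x))" for x
      by (simp only: ennreal_power powr_ge_zero)
        (simp add: powr_powr powr_realpow[symmetric] powr_add[symmetric] algebra_simps)
    show ?case
      using 1(2,3) 1(4) 1(1)[OF _ _ pw]
      by (simp add: pow2_def powr_add ennreal_mult)
  qed auto
  then show ?thesis
    using assms(1) by (simp add: tower_exponent_eq_form)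
qed

text \<open>Positivity of \<open>\<psi>\<close> on the dyadic levels keeps the convention 0 *
  \<infinity> = 0 from cancelling the infinite final factor.\<close>

lemma tower_weight_eq_top:
  assumes "length ks = length is" "tower_size is ks h = \<infinity>"
    and "\<And>k. \<psi> (pow2 k) > 0" "\<psi> \<infinity> = \<infinity>"
  shows "tower_weight \<beta> is ks \<psi> h = \<infinity>"
  using assms
proof (induction "is" ks h arbitrary: \<psi> rule: tower_size.induct)
  case (1 i "is" k ks h)
  have "tower_weight \<beta> is ks (\<lambda>x. x ^ (\<beta> i + 1)) (fiber_size i k h) = \<infinity>"
  proof (rule 1(1))
    show "0 < pow2 k ^ (\<beta> i + 1)" for k
      by (rule pow2_power_pos)
  qed (use 1(2,3) in \<open>simp_all add: top_power_ennreal\<close>)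
  then show ?case
    using 1(4)[of k] by (simp add: ennreal_mult_top)
qed simp_all

lemma tower_form_diff:
  "tower_form \<beta> is \<sigma> X - tower_form \<beta> is \<sigma> Y = tower_form \<beta> is \<sigma> (\<lambda>r. X r - Y r)"
  by (simp add: tower_form_def sum_subtractf[symmetric] algebra_simps)

text \<open>Since \<open>\<beta> 0\<close> vanishes, subtracting the form for
  \<open>\<beta> 0\<close> from that for \<open>\<beta> j\<close> cancels both the \<sigma>-term and
  the added ones, and leaves the pairing of \<open>\<beta> j\<close> with the entries
  \<open>X (Suc r)\<close>. By spanning, linear combinations of these pairings isolate each such
  entry. The form for \<open>\<beta> 0\<close> then bounds \<open>X 0\<close>, because \<sigma> is
  positive.\<close>

lemma tower_form_coercive:
  fixes \<beta> :: "nat \<Rightarrow> 'n::finite \<Rightarrow> nat"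
  assumes "N > 0" "\<sigma> > 0" "distinct is" "\<beta> 0 = (\<lambda>_. 0)"
    and span: "span ((\<lambda>j. \<chi> i. real (\<beta> j i)) ` {..<N}) = UNIV"
  shows "\<exists>C>0. \<forall>X. \<forall>r\<le>length is. \<bar>X r\<bar> \<le> C * (\<Sum>j<N. \<bar>tower_form (\<beta> j) is \<sigma> X\<bar>)"
proof -
  define S where "S X = (\<Sum>j<N. \<bar>tower_form (\<beta> j) is \<sigma> X\<bar>)" for X
  have S_nonneg: "0 \<le> S X" for X
    unfolding S_def by (intro sum_nonneg) auto
  have form_le: "\<bar>tower_form (\<beta> j) is \<sigma> X\<bar> \<le> S X" if "j < N" for j X
    unfolding S_def using that by (intro member_le_sum) auto
  define F where "F v X = (\<Sum>r<length is. v $ (is ! r) * X (Suc r))" for v :: "real ^ 'n" and X :: "nat \<Rightarrow> real"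
  have F: "\<exists>C\<ge>0. \<forall>X. \<bar>F v X\<bar> \<le> C * S X" for v
  proof -
    have "v \<in> span ((\<lambda>j. \<chi> i. real (\<beta> j i)) ` {..<N})"
      using span by simp
    then show ?thesis
    proof (induction rule: span_induct_alt)
      case base
      then show ?case by (intro exI[of _ 0]) (simp add: F_def)
    next
      case (step c x y)
      then obtain j C where j: "j < N" "x = (\<chi> i. real (\<beta> j i))" and C: "C \<ge> 0" "\<And>X. \<bar>F y X\<bar> \<le> C * S X"
        by auto
      have "\<bar>F (c *\<^sub>R x + y) X\<bar> \<le> (\<bar>c\<bar> * 2 + C) * S X" for X
      proof -
        have "F x X = tower_form (\<beta> j) is \<sigma> X - tower_form (\<beta> 0) is \<sigma> X"
          by (simp add: F_def tower_form_def j assms(4) sum_subtractf[symmetric] algebra_simps)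
        then have "\<bar>F x X\<bar> \<le> 2 * S X"
          using form_le[OF j(1), of X] form_le[OF assms(1), of X] by linarith
        then have "\<bar>c\<bar> * \<bar>F x X\<bar> \<le> \<bar>c\<bar> * (2 * S X)"
          by (rule mult_left_mono) simp
        moreover have "F (c *\<^sub>R x + y) X = c * F x X + F y X"
          by (simp add: F_def sum_distrib_left sum.distrib[symmetric] algebra_simps)
        ultimately show ?thesis
          using C(2)[of X] abs_triangle_ineq[of "c * F x X" "F y X"] by (simp add: abs_mult algebra_simps)
      qed
      then show ?case using C(1) by (intro exI[of _ "\<bar>c\<bar> * 2 + C"]) auto
    qed
  qed
  obtain c where c: "\<And>v. c v \<ge> 0" "\<And>v X. \<bar>F v X\<bar> \<le> c v * S X"
    using F by metis
  define D where "D = (\<Sum>r<length is. c (axis (is ! r) 1))"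
  have X_Suc: "\<bar>X (Suc r)\<bar> \<le> c (axis (is ! r) 1) * S X" if "r < length is" for X r
  proof -
    have "F (axis (is ! r) 1) X = (\<Sum>q<length is. if q = r then X (Suc q) else 0)"
      unfolding F_def using assms(3) that
      by (intro sum.cong) (auto simp: axis_def nth_eq_iff_index_eq)
    also have "\<dots> = X (Suc r)"
      using that by simp
    finally show ?thesis using c(2)[of "axis (is ! r) 1" X] by simp
  qed
  have D: "D \<ge> 0" "\<And>r. r < length is \<Longrightarrow> c (axis (is ! r) 1) \<le> D"
    unfolding D_def using c(1) by (auto intro!: sum_nonneg member_le_sum)
  have X_0: "\<bar>X 0\<bar> \<le> (1 + D) / \<sigma> * S X" for X
  proof -
    have "\<sigma> * X 0 = tower_form (\<beta> 0) is \<sigma> X - (\<Sum>r<length is. X (Suc r))"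
      by (simp add: tower_form_def assms(4))
    moreover have "\<bar>\<Sum>r<length is. X (Suc r)\<bar> \<le> D * S X"
      unfolding D_def sum_distrib_right using X_Suc
      by (intro order_trans[OF sum_abs] sum_mono) auto
    ultimately have "\<bar>\<sigma> * X 0\<bar> \<le> (1 + D) * S X"
      using form_le[OF assms(1), of X] by (simp add: algebra_simps)
    then show ?thesis using assms(2) by (simp add: abs_mult field_simps)
  qed
  let ?C = "D + (1 + D) / \<sigma>"
  have "\<bar>X r\<bar> \<le> ?C * S X" if "r \<le> length is" for X r
  proof (cases r)
    case 0
    have "0 \<le> D * S X" using D(1) S_nonneg by simp
    then show ?thesis using X_0[of X] 0 by (simp add: distrib_right)
  next
    case (Suc q)
    have "\<bar>X r\<bar> \<le> D * S X"
      using X_Suc[of q X] D(2)[of q] S_nonneg[of X] that Suc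
      by (auto intro: order_trans mult_right_mono)
    moreover have "0 \<le> (1 + D) / \<sigma> * S X"
      using D(1) assms(2) S_nonneg by simp
    ultimately show ?thesis by (simp add: distrib_right)
  qed
  moreover have "?C > 0" using D(1) assms(2) by (intro add_nonneg_pos) auto
  ultimately show ?thesis unfolding S_def by blast
qed

definition ennreal_powr :: "real \<Rightarrow> ennreal \<Rightarrow> ennreal" where
  "ennreal_powr \<sigma> x = (if x = \<infinity> then \<infinity> else ennreal (enn2real x powr \<sigma>))"

lemma ennreal_powr_ennreal: "r \<ge> 0 \<Longrightarrow> ennreal_powr \<sigma> (ennreal r) = ennreal (r powr \<sigma>)"
  by (simp add: ennreal_powr_def)

lemma mono_ennreal_powr: "\<sigma> \<ge> 0 \<Longrightarrow> mono (ennreal_powr \<sigma>)"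
  by (intro monoI)
    (auto simp: ennreal_powr_def top_unique less_top enn2real_mono intro!: ennreal_leI powr_mono2)

lemma ennreal_powr_measurable: "ennreal_powr \<sigma> \<in> borel_measurable borel"
  unfolding ennreal_powr_def by measurable

text \<open>This is the functional \<Phi>(\<beta>, f). A supremum is enough for the lower bound on
  the integral, since each tower is bounded separately; only the reverse estimate has to sum over
  towers.\<close>

definition tower_sup :: "('i \<Rightarrow> nat) \<Rightarrow> 'i list \<Rightarrow> (ennreal \<Rightarrow> ennreal) \<Rightarrow> (('i \<Rightarrow> real) \<Rightarrow> ennreal) \<Rightarrow> ennreal" where
  "tower_sup \<beta> is \<psi> h = (SUP ks\<in>{ks. length ks = length is}. tower_weight \<beta> is ks \<psi> h)"

lemma tower_weight_le_sup: "length ks = length is \<Longrightarrow> tower_weight \<beta> is ks \<psi> h \<le> tower_sup \<beta> is \<psi> h"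
  unfolding tower_sup_def by (intro SUP_upper) simp

lemma nn_integral_powr_abs_int:
  assumes "\<epsilon> > 0"
  shows "(\<integral>\<^sup>+k. ennreal (2 powr (- \<epsilon> * \<bar>real_of_int k\<bar>)) \<partial>count_space UNIV) < \<infinity>"
proof -
  define g where "g m = ennreal ((2 powr - \<epsilon>) ^ m)" for m :: nat
  have g: "ennreal (2 powr (- \<epsilon> * \<bar>real_of_int k\<bar>)) = g (nat \<bar>k\<bar>)" for k
    by (simp add: g_def powr_realpow[symmetric] powr_powr)
  have "2 powr - \<epsilon> < 1"
    using assms by (simp add: powr_minus_divide)
  then have "(\<Sum>m. g m) = ennreal (\<Sum>m. (2 powr - \<epsilon>) ^ m)"
    unfolding g_def by (intro suminf_ennreal2 summable_geometric) auto
  then have fin: "(\<integral>\<^sup>+m. g m \<partial>count_space UNIV) < \<infinity>"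
    by (simp add: nn_integral_count_space_nat)
  have half: "(\<integral>\<^sup>+k. g (nat \<bar>k\<bar>) * indicator (range f) k \<partial>count_space UNIV) = (\<integral>\<^sup>+m. g m \<partial>count_space UNIV)"
    if f: "inj f" "\<And>m. nat \<bar>f m\<bar> = m" for f :: "nat \<Rightarrow> int"
  proof -
    have "(\<integral>\<^sup>+m. g m \<partial>count_space UNIV) = (\<integral>\<^sup>+m. g (nat \<bar>f m\<bar>) \<partial>count_space UNIV)"
      by (simp add: f)
    also have "\<dots> = (\<integral>\<^sup>+k. g (nat \<bar>k\<bar>) \<partial>count_space (range f))"
      using f(1) by (intro nn_integral_bij_count_space) (simp add: bij_betw_def)
    also have "\<dots> = (\<integral>\<^sup>+k. g (nat \<bar>k\<bar>) * indicator (range f) k \<partial>count_space UNIV)"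
      by (rule nn_integral_count_space_indicator) simp
    finally show ?thesis ..
  qed
  have cover: "k \<in> range int \<or> k \<in> range (\<lambda>m. - int m)" for k
    by (cases k rule: int_cases2) auto
  have "(\<integral>\<^sup>+k. g (nat \<bar>k\<bar>) \<partial>count_space UNIV)
    \<le> (\<integral>\<^sup>+k. g (nat \<bar>k\<bar>) * indicator (range int) k + g (nat \<bar>k\<bar>) * indicator (range (\<lambda>m. - int m)) k \<partial>count_space UNIV)"
    using cover by (intro nn_integral_mono) (auto simp: indicator_def)
  also have "\<dots> = (\<integral>\<^sup>+m. g m \<partial>count_space UNIV) + (\<integral>\<^sup>+m. g m \<partial>count_space UNIV)"
    by (subst nn_integral_add) (auto simp: half inj_def)
  also have "\<dots> < \<infinity>"
    using fin by simp
  finally show ?thesis unfolding g .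
qed

lemma nn_integral_powr_abs_int_shift:
  "(\<integral>\<^sup>+k. ennreal (2 powr (- \<epsilon> * \<bar>real_of_int k - real_of_int l\<bar>)) \<partial>count_space UNIV)
    = (\<integral>\<^sup>+k. ennreal (2 powr (- \<epsilon> * \<bar>real_of_int k\<bar>)) \<partial>count_space UNIV)"
proof -
  have "bij (\<lambda>k :: int. k - l)"
    by (rule bij_betw_byWitness[of _ "\<lambda>k. k + l"]) auto
  from nn_integral_bij_count_space[OF this, of "\<lambda>k. ennreal (2 powr (- \<epsilon> * \<bar>real_of_int k\<bar>))"]
  show ?thesis by simp
qed

text \<open>Values rounded down to natural numbers have a least element, and rounding loses at most
  1.\<close>

lemma exists_almost_minimizer:
  fixes U :: "'a \<Rightarrow> real"
  assumes "Z \<noteq> {}" "\<And>z. z \<in> Z \<Longrightarrow> U z \<ge> 0"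
  shows "\<exists>z\<in>Z. \<forall>y\<in>Z. U z \<le> U y + 1"
proof -
  from assms(1) obtain z0 where "z0 \<in> Z" by auto
  then obtain z where z: "z \<in> Z" "\<And>y. y \<in> Z \<Longrightarrow> nat \<lfloor>U z\<rfloor> \<le> nat \<lfloor>U y\<rfloor>"
    using ex_has_least_nat[of "\<lambda>z. z \<in> Z" z0 "\<lambda>z. nat \<lfloor>U z\<rfloor>"] by blast
  have "U z \<le> U y + 1" if "y \<in> Z" for y
    using z(2)[OF that] assms(2)[OF z(1)] assms(2)[OF that] by linarith
  with z(1) show ?thesis by blast
qed

text \<open>By the balance condition the product of all tower weights is a power of the integral over
  one tower; coercivity makes the contributions of distinct towers decay geometrically away from a
  near-maximal one.\<close>

lemma nn_integral_power_le_prod_tower_sup: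
  fixes \<beta> :: "nat \<Rightarrow> 'n::finite \<Rightarrow> nat" and N w :: nat
  defines "\<sigma> \<equiv> (real N + real w) / real N"
  assumes N: "N > 0" and "is": "distinct is" "is \<noteq> []" and \<beta>0: "\<beta> 0 = (\<lambda>_. 0)"
    and span: "span ((\<lambda>j. \<chi> i. real (\<beta> j i)) ` {..<N}) = UNIV"
    and balance: "\<And>i. (\<Sum>j<N. \<beta> j i) = w"
  shows "\<exists>C>0. \<forall>h \<in> borel_measurable (lborel_PiM (set is)).
    (\<integral>\<^sup>+z. h z \<partial>lborel_PiM (set is)) ^ (N + w)
      \<le> ennreal C * (\<Prod>j<N. tower_sup (\<beta> j) is (ennreal_powr \<sigma>) h)"
proof -
  have \<sigma>: "\<sigma> > 0" using N by (simp add: \<sigma>_def)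
  define n where "n = length is"
  have n: "n > 0" using "is" by (simp add: n_def)
  obtain C where C: "C > 0" "\<And>X r. r \<le> n \<Longrightarrow> \<bar>X r\<bar> \<le> C * (\<Sum>j<N. \<bar>tower_form (\<beta> j) is \<sigma> X\<bar>)"
    using tower_form_coercive[of N \<sigma> "is" \<beta>] N \<sigma> "is"(1) \<beta>0 span unfolding n_def by metis
  \<comment> \<open>Summing the distance bound \<open>C * (2 * U ks + 1)\<close> over the
    \<open>n\<close> levels shows that the deficit \<open>U\<close> below grows at rate 1 / (2 n C)
    in the distance of two towers. Extracting the (N + w)-th root divides this rate by N +
    w.\<close>
  define \<epsilon> where "\<epsilon> = 1 / (2 * n * C * (real N + real w))"
  have \<epsilon>: "\<epsilon> > 0" using n C(1) N by (simp add: \<epsilon>_def)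
  define G where "G = (\<integral>\<^sup>+k. ennreal (2 powr (- \<epsilon> * \<bar>real_of_int k\<bar>)) \<partial>count_space UNIV)"
  have G: "G < \<infinity>" unfolding G_def by (rule nn_integral_powr_abs_int[OF \<epsilon>])
  define D where "D = ennreal (2 powr (1 / 2)) * ((2 * G) ^ n) ^ (N + w)"
  have D: "D < \<infinity>"
    using G by (auto simp: D_def ennreal_mult_less_top power_less_top_ennreal)
  \<comment> \<open>Here the exponent \<open>p\<close> is forced: by balance each fibre entry
    receives the total coefficient N + w, and \<sigma> = 1 / p is the value for which the level of
    \<open>h\<close> receives the same. The sum on the right is then the logarithm of the product of
    levels and size of one tower.\<close>
  have sum_form: "(\<Sum>j<N. tower_form (\<beta> j) is \<sigma> X) = (real N + real w) * (\<Sum>r\<le>n. X r)" for X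
  proof -
    have "(\<Sum>j<N. \<Sum>r<n. (real (\<beta> j (is ! r)) + 1) * X (Suc r))
      = (\<Sum>r<n. (\<Sum>j<N. real (\<beta> j (is ! r)) + 1) * X (Suc r))"
      by (subst sum.swap) (simp only: sum_distrib_right)
    then have "(\<Sum>j<N. tower_form (\<beta> j) is \<sigma> X)
      = real N * \<sigma> * X 0 + (\<Sum>r<n. (\<Sum>j<N. real (\<beta> j (is ! r)) + 1) * X (Suc r))"
      unfolding tower_form_def n_def[symmetric]
      by (subst sum.distrib) (simp only: sum_constant card_lessThan mult.assoc)
    also have "(\<lambda>r. (\<Sum>j<N. real (\<beta> j (is ! r)) + 1) * X (Suc r)) = (\<lambda>r. (real N + real w) * X (Suc r))"
      using balance by (simp add: sum.distrib of_nat_sum[symmetric] add.commute del: of_nat_sum)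
    also have "real N * \<sigma> = real N + real w"
      using N by (simp add: \<sigma>_def)
    finally show ?thesis
      by (simp add: sum.atMost_shift sum_distrib_left distrib_left)
  qed
  have "(\<integral>\<^sup>+z. h z \<partial>lborel_PiM (set is)) ^ (N + w)
      \<le> D * (\<Prod>j<N. tower_sup (\<beta> j) is (ennreal_powr \<sigma>) h)"
    if h: "h \<in> borel_measurable (lborel_PiM (set is))" for h
  proof -
    define \<Phi> where "\<Phi> j = tower_sup (\<beta> j) is (ennreal_powr \<sigma>) h" for j
    have \<Phi>_ge: "tower_weight (\<beta> j) is ks (ennreal_powr \<sigma>) h \<le> \<Phi> j" if "length ks = n" for j ks
      using that tower_weight_le_sup unfolding \<Phi>_def n_def by blast
    \<comment> \<open>Towers of size 0 contribute nothing and have no logarithm. If there are no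
      others, the summation lemma with zero weights shows that the integral is 0.\<close>
    define Z where "Z = {ks. length ks = n \<and> tower_size is ks h > 0}"
    show ?thesis
    proof (cases "Z = {}")
      case True
      have "(\<integral>\<^sup>+z. h z \<partial>lborel_PiM (set is)) \<le> 0 * (\<Prod>r<n. 2 * (\<integral>\<^sup>+k. 0 \<partial>count_space (UNIV :: int set)))"
        unfolding n_def using True
        by (intro nn_integral_le_of_tower_bound "is"(1) h) (auto simp: Z_def n_def)
      then show ?thesis using N by (simp add: zero_power)
    next
      case Z: False
      define y where "y ks = log 2 (enn2real (tower_size is ks h))" for ks
      define X where "X ks = (!) (map real_of_int ks @ [y ks])" for ks
      have X: "r < n \<Longrightarrow> X ks r = real_of_int (ks ! r)" "X ks n = y ks" if "length ks = n" for ks r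
        using that by (auto simp: X_def nth_append)
      have powr_eq: "ennreal_powr \<sigma> (ennreal (2 powr x)) = ennreal (2 powr (\<sigma> * x))" for x
        by (simp add: ennreal_powr_ennreal powr_powr mult.commute)
      have size: "tower_size is ks h = ennreal (2 powr y ks)"
        if "ks \<in> Z" "tower_size is ks h < \<infinity>" for ks
        using that by (simp add: Z_def y_def enn2real_positive_iff)
      have weight: "tower_weight (\<beta> j) is ks (ennreal_powr \<sigma>) h = ennreal (2 powr tower_form (\<beta> j) is \<sigma> (X ks))"
        if "ks \<in> Z" "tower_size is ks h < \<infinity>" for j ks
        using that size[OF that] unfolding X_def
        by (intro tower_weight_eq_powr powr_eq) (auto simp: Z_def n_def)
      have weight_top: "tower_weight (\<beta> j) is ks (ennreal_powr \<sigma>) h = \<infinity>"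
        if "ks \<in> Z" "tower_size is ks h = \<infinity>" for j ks
      proof (intro tower_weight_eq_top)
        show "0 < ennreal_powr \<sigma> (pow2 k)" for k
          by (simp add: pow2_def ennreal_powr_ennreal)
      qed (use that in \<open>auto simp: Z_def n_def ennreal_powr_def\<close>)
      have \<Phi>_pos: "\<Phi> j \<noteq> 0" for j
      proof -
        obtain ks where ks: "ks \<in> Z" using Z by auto
        have "tower_weight (\<beta> j) is ks (ennreal_powr \<sigma>) h \<noteq> 0"
          using weight[OF ks] weight_top[OF ks] by (cases "tower_size is ks h = \<infinity>") (auto simp: less_top)
        with \<Phi>_ge[of ks j] ks show ?thesis
          by (auto simp: Z_def)
      qed
      show ?thesis
      proof (cases "\<exists>j<N. \<Phi> j = \<infinity>")
        case True
        then have "(\<Prod>j<N. \<Phi> j) = \<infinity>"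
          using \<Phi>_pos by (auto simp: ennreal_prod_eq_top)
        \<comment> \<open>An infinite product on the right would be lost if it were multiplied by
          0.\<close>
        moreover have "D \<noteq> 0"
        proof -
          have "ennreal (2 powr (- \<epsilon> * \<bar>real_of_int 0\<bar>)) \<le> G"
            unfolding G_def by (rule nn_integral_ge_point) simp
          then have "G \<noteq> 0" by auto
          then show ?thesis by (simp add: D_def)
        qed
        ultimately show ?thesis
          by (simp add: \<Phi>_def ennreal_mult_top)
      next
        case False
        define \<phi> where "\<phi> j = log 2 (enn2real (\<Phi> j))" for j
        have \<Phi>: "\<Phi> j = ennreal (2 powr \<phi> j)" if "j < N" for j
          using False \<Phi>_pos[of j] that
          by (auto simp: \<phi>_def enn2real_positive_iff less_top zero_less_iff_neq_zero)
        \<comment> \<open>An infinite tower would make \<open>\<Phi> 0\<close> infinite, which the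
          current case excludes; from here on all logarithms are finite.\<close>
        have fin: "tower_size is ks h < \<infinity>" if "ks \<in> Z" for ks
        proof (rule ccontr)
          assume "\<not> tower_size is ks h < \<infinity>"
          then have "tower_weight (\<beta> 0) is ks (ennreal_powr \<sigma>) h = \<infinity>"
            using weight_top[OF that] by (metis infinity_ennreal_def less_top)
          with \<Phi>_ge[of ks 0] that False N show False
            by (auto simp: Z_def top_unique)
        qed
        \<comment> \<open>The deficit of one tower relative to the supremum, on the logarithmic
          scale. It is nonnegative, and by \<open>sum_form\<close> the logarithm of the tower's
          contribution is the sum of the \<open>\<phi> j\<close> minus the total deficit
          \<open>U ks\<close>, divided by N + w.\<close>
        define u where "u j ks = \<phi> j - tower_form (\<beta> j) is \<sigma> (X ks)" for j ks
        have u: "u j ks \<ge> 0" if "j < N" "ks \<in> Z" for j ks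
        proof -
          have "ennreal (2 powr tower_form (\<beta> j) is \<sigma> (X ks)) \<le> ennreal (2 powr \<phi> j)"
            using \<Phi>_ge[of ks j] weight[OF that(2) fin[OF that(2)]] \<Phi>[OF that(1)] that(2)
            by (simp add: Z_def)
          then show ?thesis by (simp add: u_def)
        qed
        define U where "U ks = (\<Sum>j<N. u j ks)" for ks
        have U: "U ks \<ge> 0" if "ks \<in> Z" for ks
          unfolding U_def using u[OF _ that] by (intro sum_nonneg) auto
        obtain ls where ls: "ls \<in> Z" "\<And>ks. ks \<in> Z \<Longrightarrow> U ls \<le> U ks + 1"
          using exists_almost_minimizer[of Z U, OF Z U] by auto
        \<comment> \<open>The largest possible contribution of a tower up to a constant; the term
          1/2 compensates for the same constant lost in \<open>U_ge\<close>, which stems from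
          \<open>ls\<close> being only an almost minimizer.\<close>
        define B where "B = 2 powr (((\<Sum>j<N. \<phi> j) + 1 / 2) / (real N + real w))"
        have tower_bound: "(\<Prod>r<n. pow2 (ks ! r)) * tower_size is ks h
          \<le> ennreal B * (\<Prod>r<n. ennreal (2 powr (- \<epsilon> * \<bar>real_of_int (ks ! r) - real_of_int (ls ! r)\<bar>)))"
          if len: "length ks = n" for ks
        proof (cases "ks \<in> Z")
          case False
          then have "tower_size is ks h = 0"
            using len by (simp add: Z_def)
          then show ?thesis by simp
        next
          case ks: True
          have "\<bar>real_of_int (ks ! r) - real_of_int (ls ! r)\<bar> \<le> C * (2 * U ks + 1)" if "r < n" for r
          proof -
            have "\<bar>X ks r - X ls r\<bar> \<le> C * (\<Sum>j<N. \<bar>tower_form (\<beta> j) is \<sigma> (\<lambda>r. X ks r - X ls r)\<bar>)"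
              using C(2)[of r "\<lambda>r. X ks r - X ls r"] that by simp
            \<comment> \<open>The two forms differ by \<open>u j ls - u j ks\<close>, whose absolute
              value is at most the sum of these two nonnegative deficits.\<close>
            also have "\<dots> \<le> C * (U ks + U ls)"
              unfolding U_def sum.distrib[symmetric] tower_form_diff[symmetric]
              using u[OF _ ks] u[OF _ ls(1)] C(1)
              by (intro mult_left_mono sum_mono) (auto simp: u_def abs_if)
            also have "\<dots> \<le> C * (2 * U ks + 1)"
              using ls(2)[OF ks] C(1) by (intro mult_left_mono) auto
            finally show ?thesis
              using X(1)[of ks r] X(1)[of ls r] that ks ls(1) by (simp add: Z_def)
          qed
          then have "(\<Sum>r<n. \<bar>real_of_int (ks ! r) - real_of_int (ls ! r)\<bar>) \<le> (\<Sum>r<n. C * (2 * U ks + 1))"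
            by (intro sum_mono) auto
          then have U_ge: "(\<Sum>r<n. \<bar>real_of_int (ks ! r) - real_of_int (ls ! r)\<bar>) / (2 * n * C) - 1 / 2 \<le> U ks"
            using n C(1) by (simp add: field_simps)
          have "(\<Prod>r<n. pow2 (ks ! r)) * tower_size is ks h = ennreal (2 powr (\<Sum>r\<le>n. X ks r))"
          proof -
            have "(\<Prod>r<n. pow2 (ks ! r)) = ennreal (2 powr (\<Sum>r<n. X ks r))"
              using X(1)[OF len] by (simp add: pow2_def prod_ennreal powr_sum)
            then show ?thesis
              using size[OF ks fin[OF ks]] X(2)[OF len]
              by (simp add: ennreal_mult[symmetric] powr_add[symmetric] lessThan_Suc_atMost[symmetric])
          qed
          also have "(\<Sum>r\<le>n. X ks r) = ((\<Sum>j<N. \<phi> j) - U ks) / (real N + real w)"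
            using sum_form[of "X ks"] N by (simp add: U_def u_def sum_subtractf field_simps)
          also have "2 powr \<dots> \<le> B * 2 powr (- \<epsilon> * (\<Sum>r<n. \<bar>real_of_int (ks ! r) - real_of_int (ls ! r)\<bar>))"
          proof -
            have "((\<Sum>j<N. \<phi> j) - U ks) / (real N + real w)
              \<le> ((\<Sum>j<N. \<phi> j) + 1 / 2 - (\<Sum>r<n. \<bar>real_of_int (ks ! r) - real_of_int (ls ! r)\<bar>) / (2 * n * C)) / (real N + real w)"
              using U_ge N by (intro divide_right_mono) auto
            then show ?thesis
              unfolding B_def powr_add[symmetric] \<epsilon>_def
              by (intro powr_mono) (auto simp: diff_divide_distrib add_divide_distrib)
          qed
          also have "ennreal (B * 2 powr (- \<epsilon> * (\<Sum>r<n. \<bar>real_of_int (ks ! r) - real_of_int (ls ! r)\<bar>)))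
            = ennreal B * (\<Prod>r<n. ennreal (2 powr (- \<epsilon> * \<bar>real_of_int (ks ! r) - real_of_int (ls ! r)\<bar>)))"
            by (simp add: prod_ennreal powr_sum[symmetric] ennreal_mult B_def sum_distrib_left)
          finally show ?thesis by (simp add: ennreal_leI)
        qed
        have "(\<integral>\<^sup>+z. h z \<partial>lborel_PiM (set is)) \<le> ennreal B * (2 * G) ^ n"
          using nn_integral_le_of_tower_bound[OF "is"(1) h tower_bound[unfolded n_def]]
          unfolding nn_integral_powr_abs_int_shift G_def[symmetric] by (simp add: n_def)
        then have "(\<integral>\<^sup>+z. h z \<partial>lborel_PiM (set is)) ^ (N + w) \<le> (ennreal B * (2 * G) ^ n) ^ (N + w)"
          by (intro power_mono) auto
        also have "\<dots> = ennreal (B ^ (N + w)) * ((2 * G) ^ n) ^ (N + w)"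
          by (simp only: power_mult_distrib) (simp add: ennreal_power B_def)
        also have "B ^ (N + w) = 2 powr (1 / 2) * (\<Prod>j<N. 2 powr \<phi> j)"
        proof -
          have "B ^ (N + w) = B powr (real N + real w)"
            by (simp add: B_def powr_realpow[symmetric])
          also have "\<dots> = 2 powr ((\<Sum>j<N. \<phi> j) + 1 / 2)"
            using N by (simp add: B_def powr_powr)
          finally show ?thesis by (simp add: powr_add powr_sum)
        qed
        also have "ennreal \<dots> = ennreal (2 powr (1 / 2)) * (\<Prod>j<N. \<Phi> j)"
          by (simp add: ennreal_mult prod_nonneg prod_ennreal[symmetric] \<Phi>)
        finally show ?thesis
          by (simp add: D_def \<Phi>_def mult_ac)
      qed
    qed
  qed
  moreover have "D \<le> ennreal (enn2real D + 1)"
    using D by (cases D) (auto intro!: ennreal_leI)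
  ultimately have "\<forall>h \<in> borel_measurable (lborel_PiM (set is)).
    (\<integral>\<^sup>+z. h z \<partial>lborel_PiM (set is)) ^ (N + w)
      \<le> ennreal (enn2real D + 1) * (\<Prod>j<N. tower_sup (\<beta> j) is (ennreal_powr \<sigma>) h)"
    by (meson mult_right_mono order_trans zero_le)
  moreover have "enn2real D + 1 > 0"
    using enn2real_nonneg[of D] by linarith
  ultimately show ?thesis by blast
qed

subsection \<open>The Vandermonde integral\<close>

lemma vec_lambda_measurable:
  "(\<lambda>z. \<chi> i. z i) \<in> lborel_PiM (UNIV :: 'n::finite set) \<rightarrow>\<^sub>M (borel :: (real ^ 'n) measure)"
proof (subst borel_measurable_euclidean_space, intro ballI)
  fix b :: "real ^ 'n" assume "b \<in> Basis"
  then obtain i where b: "b = axis i 1"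
    by (auto simp: Basis_vec_def)
  have "(\<lambda>z. z i) \<in> lborel_PiM (UNIV :: 'n set) \<rightarrow>\<^sub>M lborel"
    by (rule measurable_component_singleton) simp
  then show "(\<lambda>z. (\<chi> i. z i) \<bullet> b) \<in> borel_measurable (lborel_PiM (UNIV :: 'n set))"
    by (simp add: b inner_axis)
qed

lemma lborel_eq_distr_PiM:
  "(lborel :: (real ^ 'n::finite) measure) = distr (lborel_PiM UNIV) borel (\<lambda>z. \<chi> i. z i)"
proof (rule lborel_eqI)
  fix l u :: "real ^ 'n"
  assume lu: "\<And>b. b \<in> Basis \<Longrightarrow> l \<bullet> b \<le> u \<bullet> b"
  have le: "l $ i \<le> u $ i" for i
    using lu[of "axis i 1"] by (simp add: inner_axis axis_in_Basis_iff)
  have "(\<lambda>z. \<chi> i. z i) -` box l u \<inter> space (lborel_PiM UNIV) = (\<Pi>\<^sub>E i\<in>UNIV. {l $ i<..<u $ i})"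
    by (auto simp: space_PiM mem_box_cart PiE_iff)
  then have "emeasure (distr (lborel_PiM UNIV) borel (\<lambda>z. \<chi> i. z i)) (box l u)
    = emeasure (lborel_PiM UNIV) (\<Pi>\<^sub>E i\<in>UNIV. {l $ i<..<u $ i})"
    using vec_lambda_measurable by (subst emeasure_distr) auto
  also have "\<dots> = (\<Prod>i\<in>UNIV. emeasure lborel {l $ i<..<u $ i})"
    by (rule lborel_product.emeasure_PiM) auto
  also have "\<dots> = (\<Prod>i\<in>UNIV. ennreal ((u - l) $ i))"
    using le by simp
  also have "\<dots> = (\<Prod>b\<in>(\<lambda>i. axis i 1) ` UNIV. ennreal ((u - l) \<bullet> b))"
    by (subst prod.reindex) (auto simp: inj_on_def axis_eq_axis inner_axis)
  also have "(\<lambda>i. axis i 1) ` UNIV = (Basis :: (real ^ 'n) set)"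
    by (auto simp: Basis_vec_def)
  finally show "emeasure (distr (lborel_PiM UNIV) borel (\<lambda>z. \<chi> i. z i)) (box l u)
    = ennreal (\<Prod>b\<in>Basis. (u - l) \<bullet> b)"
    using lu by (simp add: prod_ennreal inner_diff_left)
qed simp

lemma nn_integral_lborel_vec:
  fixes F :: "real ^ 'n::finite \<Rightarrow> ennreal"
  assumes "F \<in> borel_measurable borel"
  shows "(\<integral>\<^sup>+y. F y \<partial>lborel) = (\<integral>\<^sup>+z. F (\<chi> i. z i) \<partial>lborel_PiM UNIV)"
  by (subst lborel_eq_distr_PiM, subst nn_integral_distr[OF vec_lambda_measurable])
    (simp_all add: assms)

lemma monomial_measurable: "(\<lambda>y. monomial y \<alpha>) \<in> borel_measurable borel"
  unfolding monomial_def by (intro borel_measurable_continuous_onI continuous_intros)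

text \<open>For each \<open>k\<close> the exponent \<open>\<alpha> k M\<close> is strictly largest
  in dictionary order, so the coordinatewise induction ends with the single coefficient
  \<open>c k M\<close>. Leading exponents add under multiplication, which gives \<beta>. The bound
  holds for every tower, hence for the supremum.\<close>

lemma nn_integral_prod_monomials_ge:
  fixes \<alpha> :: "nat \<Rightarrow> nat \<Rightarrow> 'n::{finite,linorder} multiindex" and M :: nat and K :: "nat set"
    and h :: "real ^ 'n::{finite,linorder} \<Rightarrow> ennreal"
  defines "\<beta> \<equiv> \<lambda>i. \<Sum>k\<in>K. \<alpha> k M i"
  assumes K: "finite K" and less: "\<And>k m. k \<in> K \<Longrightarrow> m < M \<Longrightarrow> less_fun (\<alpha> k m) (\<alpha> k M)"
    and h: "h \<in> borel_measurable borel" and \<psi>: "mono \<psi>" "\<psi> \<in> borel_measurable borel"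
  shows "ennreal (\<Prod>i\<in>UNIV. sublevel_const (\<beta> i)) * ennreal (\<Prod>k\<in>K. \<bar>c k M\<bar>) *
      tower_sup \<beta> (sorted_list_of_set UNIV) \<psi> (\<lambda>z. h (\<chi> i. z i))
    \<le> (\<integral>\<^sup>+y. ennreal (\<Prod>k\<in>K. \<bar>\<Sum>m\<le>M. c k m * monomial y (\<alpha> k m)\<bar>) * \<psi> (h y) \<partial>lborel)"
proof -
  let ?is = "sorted_list_of_set UNIV :: 'n list"
  let ?h = "\<lambda>z. h (\<chi> i. z i)"
  have set: "set ?is = UNIV" by simp
  have lead: "{m \<in> {..M}. \<forall>i\<in>set ?is. \<alpha> k m i = \<alpha> k M i} = {M}" if "k \<in> K" for k
  proof -
    have "m = M" if "m \<le> M" "\<forall>i. \<alpha> k m i = \<alpha> k M i" for m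
    proof (rule ccontr)
      assume "m \<noteq> M"
      with that(1) have "less_fun (\<alpha> k m) (\<alpha> k M)"
        by (intro less \<open>k \<in> K\<close>) auto
      moreover have "\<alpha> k m = \<alpha> k M" using that(2) by auto
      ultimately show False using less_fun_irrefl by auto
    qed
    then show ?thesis by auto
  qed
  have "ennreal (\<Prod>i\<in>UNIV. sublevel_const (\<beta> i)) * ennreal (\<Prod>k\<in>K. \<bar>c k M\<bar>) * tower_weight \<beta> ?is ks \<psi> ?h
    \<le> (\<integral>\<^sup>+z. ennreal (\<Prod>k\<in>K. \<bar>poly_in {..M} (c k) (\<alpha> k) UNIV z\<bar>) * \<psi> (?h z) \<partial>lborel_PiM UNIV)"
    if len: "length ks = length ?is" for ks
  proof -
    have "ennreal (\<Prod>i\<in>set ?is. sublevel_const (\<beta> i)) *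
      ennreal (\<Prod>k\<in>K. \<bar>\<Sum>m | m \<in> {..M} \<and> (\<forall>i\<in>set ?is. \<alpha> k m i = \<alpha> k M i). c k m\<bar>) *
      tower_weight \<beta> ?is ks \<psi> ?h
      \<le> (\<integral>\<^sup>+z. ennreal (\<Prod>k\<in>K. \<bar>poly_in {..M} (c k) (\<alpha> k) (set ?is) z\<bar>) * \<psi> (?h z) \<partial>lborel_PiM (set ?is))"
      unfolding \<beta>_def
    proof (rule nn_integral_prod_poly_ge_tower[OF _ K _ _ _ \<psi> len])
      show "sorted_wrt (<) ?is" by (rule strict_sorted_list_of_set)
      show "?h \<in> borel_measurable (lborel_PiM (set ?is))"
        using measurable_compose[OF vec_lambda_measurable h] by simp
    next
      fix k m i
      assume km: "k \<in> K" "m \<in> {..M}" and eq: "\<forall>i'\<in>set ?is. i' < i \<longrightarrow> \<alpha> k m i' = \<alpha> k M i'"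
      show "\<alpha> k m i \<le> \<alpha> k M i"
      proof (cases "m = M")
        case False
        with km less[of k m] obtain i0 where i0: "\<alpha> k m i0 < \<alpha> k M i0" "\<And>i'. i' < i0 \<Longrightarrow> \<alpha> k m i' = \<alpha> k M i'"
          by (auto simp: less_fun_def)
        \<comment> \<open>\<open>i0\<close> is the first coordinate at which the two exponents
          differ. Agreement before \<open>i\<close> places it at \<open>i\<close> or later, so the
          entries at \<open>i\<close> are either equal or already strictly ordered.\<close>
        have "\<not> i0 < i"
          using eq i0(1) by (auto simp: set)
        then show ?thesis
          using i0 by (cases i i0 rule: linorder_cases) auto
      qed simp
    qed auto
    moreover have "(\<Prod>k\<in>K. \<bar>\<Sum>m | m \<in> {..M} \<and> (\<forall>i\<in>set ?is. \<alpha> k m i = \<alpha> k M i). c k m\<bar>) = (\<Prod>k\<in>K. \<bar>c k M\<bar>)"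
    proof (intro prod.cong refl)
      fix k assume "k \<in> K"
      show "\<bar>\<Sum>m | m \<in> {..M} \<and> (\<forall>i\<in>set ?is. \<alpha> k m i = \<alpha> k M i). c k m\<bar> = \<bar>c k M\<bar>"
        unfolding lead[OF \<open>k \<in> K\<close>] by simp
    qed
    ultimately show ?thesis
      by (simp only: set)
  qed
  then have "ennreal (\<Prod>i\<in>UNIV. sublevel_const (\<beta> i)) * ennreal (\<Prod>k\<in>K. \<bar>c k M\<bar>) * tower_sup \<beta> ?is \<psi> ?h
    \<le> (\<integral>\<^sup>+z. ennreal (\<Prod>k\<in>K. \<bar>poly_in {..M} (c k) (\<alpha> k) UNIV z\<bar>) * \<psi> (?h z) \<partial>lborel_PiM UNIV)"
    unfolding tower_sup_def by (subst SUP_mult_left_ennreal) (auto intro!: SUP_least)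
  also have "\<dots> = (\<integral>\<^sup>+z. ennreal (\<Prod>k\<in>K. \<bar>\<Sum>m\<le>M. c k m * monomial (\<chi> i. z i) (\<alpha> k m)\<bar>) * \<psi> (?h z) \<partial>lborel_PiM UNIV)"
    by (simp add: poly_in_def monomial_def)
  also have "\<dots> = (\<integral>\<^sup>+y. ennreal (\<Prod>k\<in>K. \<bar>\<Sum>m\<le>M. c k m * monomial y (\<alpha> k m)\<bar>) * \<psi> (h y) \<partial>lborel)"
    by (intro nn_integral_lborel_vec[symmetric] borel_measurable_times_ennreal measurable_compose[OF h \<psi>(2)]
          measurable_compose[OF _ measurable_ennreal] borel_measurable_prod borel_measurable_abs borel_measurable_sum
          borel_measurable_times borel_measurable_const monomial_measurable)
  finally show ?thesis .
qed

text \<open>Stated through the entry function instead of a matrix, so that independence of row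
  \<open>M\<close> is a plain congruence: the cofactors stay fixed while the last variable is
  integrated.\<close>

definition last_row_cofactor :: "(nat \<Rightarrow> nat \<Rightarrow> 'a::comm_ring_1) \<Rightarrow> nat \<Rightarrow> nat \<Rightarrow> 'a" where
  "last_row_cofactor a M m =
     (-1) ^ (M + m) * Determinant.det (Matrix.mat M M (\<lambda>(i, j). a i (if j < m then j else Suc j)))"

lemma det_expand_last_row:
  "Determinant.det (Matrix.mat (Suc M) (Suc M) (\<lambda>(i, j). a i j))
    = (\<Sum>m\<le>M. last_row_cofactor a M m * a M m)"
proof -
  let ?A = "Matrix.mat (Suc M) (Suc M) (\<lambda>(i, j). a i j)"
  have "Determinant.det ?A = (\<Sum>m<Suc M. ?A $$ (M, m) * cofactor ?A M m)"
    by (rule laplace_expansion_row) auto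
  also have "\<dots> = (\<Sum>m<Suc M. last_row_cofactor a M m * a M m)"
  proof (intro sum.cong refl)
    fix m assume m: "m \<in> {..<Suc M}"
    have "mat_delete ?A M m = Matrix.mat M M (\<lambda>(i, j). a i (if j < m then j else Suc j))"
      using m by (intro eq_matI) (auto simp: mat_delete_def)
    then show "?A $$ (M, m) * cofactor ?A M m = last_row_cofactor a M m * a M m"
      using m by (simp add: cofactor_def last_row_cofactor_def mult.commute)
  qed
  finally show ?thesis by (simp add: lessThan_Suc_atMost)
qed

lemma last_row_cofactor_cong:
  "(\<And>i j. i < M \<Longrightarrow> a i j = b i j) \<Longrightarrow> last_row_cofactor a M m = last_row_cofactor b M m"
  unfolding last_row_cofactor_def
  by (intro arg_cong2[of _ _ _ _ "(*)"] arg_cong[of _ _ Determinant.det] cong_mat) auto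

lemma last_row_cofactor_last:
  "last_row_cofactor a M M = Determinant.det (Matrix.mat M M (\<lambda>(i, j). a i j))"
  unfolding last_row_cofactor_def by (auto intro!: arg_cong[of _ _ Determinant.det] cong_mat)

lemma det_measurable:
  assumes "\<And>i j. i < M \<Longrightarrow> j < M \<Longrightarrow> (\<lambda>x. a x i j) \<in> borel_measurable L"
  shows "(\<lambda>x. Determinant.det (Matrix.mat M M (\<lambda>(i, j). a x i j)) :: real) \<in> borel_measurable L"
proof -
  have "Determinant.det (Matrix.mat M M (\<lambda>(i, j). a x i j))
    = (\<Sum>p | p permutes {0..<M}. signof p * (\<Prod>i = 0..<M. a x i (p i)))" for x
    by (subst det_def'[of _ M]) (auto intro!: sum.cong prod.cong simp: permutes_in_image)
  then show ?thesis
    using assms by (auto intro!: borel_measurable_sum borel_measurable_times borel_measurable_prod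
      simp: permutes_in_image)
qed

lemma sigma_finite_lebesgue: "sigma_finite_measure (lebesgue :: 'a::euclidean_space measure)"
proof -
  obtain A :: "'a set set" where "countable A" "A \<subseteq> sets lborel" "\<Union>A = space lborel"
    "\<forall>a\<in>A. emeasure lborel a \<noteq> \<infinity>"
    using lborel.sigma_finite_countable by blast
  then show ?thesis
    by (intro sigma_finite_measure.intro exI[of _ A]) (auto simp: sets_completionI_sets subset_eq)
qed

interpretation lebesgue_product: product_sigma_finite "\<lambda>_ :: nat. lebesgue :: (real ^ 'n::finite) measure"
  by (intro product_sigma_finite.intro sigma_finite_lebesgue)

text \<open>Expanding along the row of the last variable, its dictionary-leading coefficient is the minor
  in the remaining variables. The injection \<open>\<tau>\<close> prescribes which variable plays which role.\<close>

lemma nn_integral_det_prod_ge: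
  fixes \<alpha> :: "nat \<Rightarrow> nat \<Rightarrow> 'n::{finite,linorder} multiindex" and K :: "nat set"
    and h :: "nat \<Rightarrow> real ^ 'n::{finite,linorder} \<Rightarrow> ennreal"
  defines "\<beta> \<equiv> \<lambda>r i. \<Sum>k\<in>K. \<alpha> k r i"
  assumes K: "finite K" and less: "\<And>k l m. k \<in> K \<Longrightarrow> l < m \<Longrightarrow> m < M \<Longrightarrow> less_fun (\<alpha> k l) (\<alpha> k m)"
    and h: "\<And>j. h j \<in> borel_measurable borel" and \<psi>: "mono \<psi>" "\<psi> \<in> borel_measurable borel"
    and \<tau>: "inj_on \<tau> {..<M}"
  shows "(\<Prod>r<M. ennreal (\<Prod>i\<in>UNIV. sublevel_const (\<beta> r i)) *
      tower_sup (\<beta> r) (sorted_list_of_set UNIV) \<psi> (\<lambda>z. h (\<tau> r) (\<chi> i. z i)))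
    \<le> (\<integral>\<^sup>+x. ennreal (\<Prod>k\<in>K. \<bar>Determinant.det (Matrix.mat M M (\<lambda>(r, m). monomial (x (\<tau> r)) (\<alpha> k m)))\<bar>) *
        (\<Prod>j\<in>\<tau> ` {..<M}. \<psi> (h j (x j))) \<partial>(\<Pi>\<^sub>M j\<in>\<tau> ` {..<M}. lebesgue))"
  using less \<tau>
proof (induction M)
  case 0
  then show ?case
    by (simp add: PiM_empty nn_integral_count_space_finite det_def)
next
  case (Suc M)
  let ?J = "\<tau> ` {..<M}"
  let ?L = "\<lambda>J. \<Pi>\<^sub>M j\<in>J. (lebesgue :: (real ^ 'n::{finite,linorder}) measure)"
  define V where "V M x = (\<Prod>k\<in>K. \<bar>Determinant.det (Matrix.mat M M (\<lambda>(r, m). monomial (x (\<tau> r)) (\<alpha> k m)))\<bar>)"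
    for M and x :: "nat \<Rightarrow> real ^ 'n::{finite,linorder}"
  define W where "W r = ennreal (\<Prod>i\<in>UNIV. sublevel_const (\<beta> r i)) *
      tower_sup (\<beta> r) (sorted_list_of_set UNIV) \<psi> (\<lambda>z. h (\<tau> r) (\<chi> i. z i))" for r
  have \<tau>M: "\<tau> M \<notin> ?J" "inj_on \<tau> {..<M}" and \<tau>_neq: "\<And>r. r < M \<Longrightarrow> \<tau> r \<noteq> \<tau> M"
    using Suc.prems(2) by (auto simp: lessThan_Suc inj_on_def)
  have J: "\<tau> ` {..<Suc M} = insert (\<tau> M) ?J" by (auto simp: lessThan_Suc)
  have IH: "(\<Prod>r<M. W r) \<le> (\<integral>\<^sup>+x. ennreal (V M x) * (\<Prod>j\<in>?J. \<psi> (h j (x j))) \<partial>?L ?J)"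
    unfolding V_def W_def by (rule Suc.IH[OF Suc.prems(1) \<tau>M(2)]) auto
  have comp: "(\<lambda>x. F (x j)) \<in> borel_measurable (?L I)" if "F \<in> borel_measurable borel" "j \<in> I"
    for F :: "real ^ 'n::{finite,linorder} \<Rightarrow> 'c::topological_space" and j I
  proof -
    have "F \<in> borel_measurable lebesgue"
      using that(1) by (intro measurable_completion) simp
    from measurable_compose[OF measurable_component_singleton[OF that(2)] this]
    show ?thesis .
  qed
  have V_meas: "V m \<in> borel_measurable (?L I)" if "\<tau> ` {..<m} \<subseteq> I" for m I
    unfolding V_def using that
    by (intro borel_measurable_prod borel_measurable_abs det_measurable comp monomial_measurable) auto
  have prod_meas: "(\<lambda>x. \<Prod>j\<in>I. \<psi> (h j (x j))) \<in> borel_measurable (?L I)" for I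
    by (intro borel_measurable_prod_ennreal comp measurable_compose[OF h \<psi>(2)])
  have inner: "W M * (ennreal (V M x) * (\<Prod>j\<in>?J. \<psi> (h j (x j))))
    \<le> (\<integral>\<^sup>+y. ennreal (V (Suc M) (x(\<tau> M := y))) * (\<Prod>j\<in>insert (\<tau> M) ?J. \<psi> (h j ((x(\<tau> M := y)) j))) \<partial>lebesgue)" for x
  proof -
    define c where "c k m = last_row_cofactor (\<lambda>r m. monomial (x (\<tau> r)) (\<alpha> k m)) M m" for k m
    define P where "P = (\<Prod>j\<in>?J. \<psi> (h j (x j)))"
    \<comment> \<open>Only row \<open>M\<close> contains the new variable \<open>y\<close>. For
      fixed other variables, each determinant is therefore a combination of the monomials in
      \<open>y\<close> with constant coefficients.\<close>
    have cof: "last_row_cofactor (\<lambda>r m. monomial ((x(\<tau> M := y)) (\<tau> r)) (\<alpha> k m)) M m = c k m" for k m y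
      unfolding c_def using \<tau>_neq by (intro last_row_cofactor_cong) auto
    have V_Suc: "V (Suc M) (x(\<tau> M := y)) = (\<Prod>k\<in>K. \<bar>\<Sum>m\<le>M. c k m * monomial y (\<alpha> k m)\<bar>)" for y
      unfolding V_def by (subst det_expand_last_row) (simp only: cof fun_upd_same)
    \<comment> \<open>The coefficient of the leading monomial is the minor without the last row and
      column, with sign +1. Hence the one-variable bound returns exactly the product for one
      variable fewer.\<close>
    have V_M: "V M x = (\<Prod>k\<in>K. \<bar>c k M\<bar>)"
      unfolding V_def c_def last_row_cofactor_last ..
    have prod_upd: "(\<Prod>j\<in>insert (\<tau> M) ?J. \<psi> (h j ((x(\<tau> M := y)) j))) = \<psi> (h (\<tau> M) y) * P" for y
    proof -
      have "(\<Prod>j\<in>?J. \<psi> (h j ((x(\<tau> M := y)) j))) = P"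
        unfolding P_def using \<tau>_neq by (intro prod.cong) auto
      then show ?thesis
        using \<tau>M(1) by (subst prod.insert) (simp_all del: fun_upd_apply add: fun_upd_same)
    qed
    have meas: "(\<lambda>y. ennreal (\<Prod>k\<in>K. \<bar>\<Sum>m\<le>M. c k m * monomial y (\<alpha> k m)\<bar>) * \<psi> (h (\<tau> M) y)) \<in> borel_measurable borel"
      by (intro borel_measurable_times_ennreal measurable_compose[OF h \<psi>(2)]
          measurable_compose[OF _ measurable_ennreal] borel_measurable_prod borel_measurable_abs borel_measurable_sum
          borel_measurable_times borel_measurable_const monomial_measurable)
    have "W M * ennreal (V M x)
      \<le> (\<integral>\<^sup>+y. ennreal (\<Prod>k\<in>K. \<bar>\<Sum>m\<le>M. c k m * monomial y (\<alpha> k m)\<bar>) * \<psi> (h (\<tau> M) y) \<partial>lborel)"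
      using nn_integral_prod_monomials_ge[of K M \<alpha> "h (\<tau> M)" \<psi> c, OF K _ h \<psi>] Suc.prems(1)
      by (simp add: W_def V_M \<beta>_def mult_ac)
    then have "W M * ennreal (V M x) * P
      \<le> (\<integral>\<^sup>+y. ennreal (\<Prod>k\<in>K. \<bar>\<Sum>m\<le>M. c k m * monomial y (\<alpha> k m)\<bar>) * \<psi> (h (\<tau> M) y) \<partial>lborel) * P"
      by (rule mult_right_mono) simp
    also have "\<dots> = (\<integral>\<^sup>+y. ennreal (\<Prod>k\<in>K. \<bar>\<Sum>m\<le>M. c k m * monomial y (\<alpha> k m)\<bar>) * \<psi> (h (\<tau> M) y) * P \<partial>lborel)"
      using meas by (intro nn_integral_multc[symmetric]) simp
    finally show ?thesis
      unfolding prod_upd V_Suc nn_integral_completion P_def[symmetric] by (simp only: mult.assoc)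
  qed
  have "(\<Prod>r<Suc M. W r) = W M * (\<Prod>r<M. W r)"
    by (simp add: mult.commute)
  also have "\<dots> \<le> W M * (\<integral>\<^sup>+x. ennreal (V M x) * (\<Prod>j\<in>?J. \<psi> (h j (x j))) \<partial>?L ?J)"
    by (intro mult_left_mono IH) simp
  also have "\<dots> = (\<integral>\<^sup>+x. W M * (ennreal (V M x) * (\<Prod>j\<in>?J. \<psi> (h j (x j)))) \<partial>?L ?J)"
    by (intro nn_integral_cmult[symmetric] borel_measurable_times_ennreal prod_meas
        measurable_compose[OF V_meas measurable_ennreal]) auto
  also have "\<dots> \<le> (\<integral>\<^sup>+x. \<integral>\<^sup>+y. ennreal (V (Suc M) (x(\<tau> M := y))) *
      (\<Prod>j\<in>insert (\<tau> M) ?J. \<psi> (h j ((x(\<tau> M := y)) j))) \<partial>lebesgue \<partial>?L ?J)"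
    by (intro nn_integral_mono inner)
  also have "\<dots> = (\<integral>\<^sup>+x. ennreal (V (Suc M) x) * (\<Prod>j\<in>insert (\<tau> M) ?J. \<psi> (h j (x j))) \<partial>?L (insert (\<tau> M) ?J))"
    using \<tau>M(1)
    by (intro lebesgue_product.product_nn_integral_insert[symmetric] borel_measurable_times_ennreal prod_meas
        measurable_compose[OF V_meas measurable_ennreal]) (auto simp: lessThan_Suc)
  finally show ?case
    unfolding W_def V_def J .
qed

section \<open>Powers, Borel minorants, enumerations and permutations for the final assembly\<close>

lemma ennreal_power_le_cancel:
  fixes a b :: ennreal
  assumes "a ^ n \<le> b ^ n" "n > 0"
  shows "a \<le> b"
proof (rule ccontr)
  assume "\<not> a \<le> b"
  then have ba: "b < a" by simp
  then obtain r where r: "b = ennreal r" "r \<ge> 0"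
    by (cases b) auto
  show False
  proof (cases a)
    case (real q)
    with ba r have "r < q" by (simp add: ennreal_less_iff)
    then have "r ^ n < q ^ n"
      using r(2) assms(2) by (intro power_strict_mono) auto
    then show False
      using assms(1) real r by (simp add: ennreal_power)
  next
    case top
    then show False
      using assms r by (simp add: ennreal_power top_power_ennreal top_unique)
  qed
qed

lemma prod_mono_ennreal:
  fixes f g :: "'i \<Rightarrow> ennreal"
  assumes "\<And>i. i \<in> I \<Longrightarrow> f i \<le> g i"
  shows "prod f I \<le> prod g I"
  using assms by (induction I rule: infinite_finite_induct) (auto intro!: mult_mono)

text \<open>The passage to coordinates composes with a map that is measurable into the Borel sets,
  so Borel functions are required. The minorant lies below everywhere, so that the integrands on the
  product space compare pointwise; equality almost everywhere is enough to preserve the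
  norm.\<close>

lemma lebesgue_measurable_borel_minorant:
  fixes f :: "'a::euclidean_space \<Rightarrow> complex"
  assumes "f \<in> borel_measurable lebesgue"
  shows "\<exists>g \<in> borel_measurable borel. (\<forall>x. 0 \<le> g x \<and> g x \<le> norm (f x)) \<and> (AE x in lborel. g x = norm (f x))"
proof -
  have "(\<lambda>x. norm (f x)) \<in> borel_measurable (completion lborel)"
    using assms by simp
  from completion_ex_borel_measurable_real[OF this]
  obtain b where b: "b \<in> borel_measurable lborel" "AE x in lborel. norm (f x) = b x"
    by blast
  obtain Z where Z: "{x \<in> space lborel. norm (f x) \<noteq> b x} \<subseteq> Z" "Z \<in> null_sets lborel"
    using b(2)[unfolded eventually_ae_filter] by blast
  let ?g = "\<lambda>x. b x * indicator (- Z) x"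
  have "?g \<in> borel_measurable borel"
    using b(1) Z(2) by auto
  moreover have "0 \<le> ?g x \<and> ?g x \<le> norm (f x)" for x
  proof (cases "x \<in> Z")
    case False
    then have "x \<notin> {x \<in> space lborel. norm (f x) \<noteq> b x}" using Z(1) by blast
    then have "b x = norm (f x)" by simp
    with False show ?thesis by simp
  qed simp
  moreover have "AE x in lborel. ?g x = norm (f x)"
    using AE_not_in[OF Z(2)] b(2) by eventually_elim auto
  ultimately show ?thesis
    by (intro bexI[of _ ?g] conjI allI) auto
qed

text \<open>The N-th power clears the fractional exponent, as N / p = N + w.\<close>

lemma lp_norm_power_le:
  assumes "N > 0"
  shows "lp_norm (real N / (real N + real w)) f ^ N
    \<le> (\<integral>\<^sup>+t. ennreal (norm (f t) powr (real N / (real N + real w))) \<partial>lebesgue) ^ (N + w)"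
proof -
  define I where "I = (\<integral>\<^sup>+t. ennreal (norm (f t) powr (real N / (real N + real w))) \<partial>lebesgue)"
  have "lp_norm (real N / (real N + real w)) f ^ N \<le> I ^ (N + w)"
  proof (cases I)
    case (real r)
    show ?thesis
    proof (cases "r = 0")
      case True
      with real assms show ?thesis
        by (simp add: lp_norm_def I_def[symmetric] Let_def zero_power)
    next
      case False
      with real have r: "r > 0" by simp
      have "(r powr (1 / (real N / (real N + real w)))) ^ N = r powr ((1 / (real N / (real N + real w))) * real N)"
        using r by (simp add: powr_powr powr_realpow[symmetric])
      also have "\<dots> = r ^ (N + w)"
        using assms r by (simp add: powr_realpow[symmetric])
      finally show ?thesis
        using real by (simp add: lp_norm_def I_def[symmetric] Let_def ennreal_power)
    qed
  next
    case top
    then show ?thesis using assms by (simp add: top_power_ennreal)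
  qed
  then show ?thesis by (simp only: I_def)
qed

lemma sum_nth_dict_enum:
  fixes S :: "'n::{finite,linorder} multiindex set"
  assumes "finite S"
  shows "(\<Sum>j<card S. F (dict_enum S ! j)) = (\<Sum>\<alpha>\<in>S. F \<alpha>)"
proof -
  note enum = dict_enum[OF assms]
  have "distinct (dict_enum S)"
    unfolding distinct_conv_nth
  proof (intro allI impI)
    fix i j assume ij: "i < length (dict_enum S)" "j < length (dict_enum S)" "i \<noteq> j"
    have neq: "\<alpha> \<noteq> \<beta>" if "less_fun \<alpha> \<beta>" for \<alpha> \<beta> :: "'n::{finite,linorder} multiindex"
      using that by (auto simp: less_fun_def)
    from ij(3) consider "i < j" | "j < i" by linarith
    then show "dict_enum S ! i \<noteq> dict_enum S ! j"
      using neq[OF sorted_wrt_nth_less[OF enum(1), of i j]] neq[OF sorted_wrt_nth_less[OF enum(1), of j i]] ij(1,2)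
      by cases auto
  qed
  then have "bij_betw ((!) (dict_enum S)) {..<card S} S"
    using enum(2,3) by (intro bij_betw_nth) auto
  from sum.reindex_bij_betw[OF this, of F] show ?thesis .
qed

text \<open>Zero is the least multiindex in dictionary order. This supplies the condition
  \<open>\<beta> 0 = 0\<close> on which coercivity rests.\<close>

lemma dict_enum_nth_0:
  assumes "finite S" "(\<lambda>i. 0) \<in> S"
  shows "dict_enum S ! 0 = (\<lambda>i. 0)"
proof -
  note enum = dict_enum[OF assms(1)]
  obtain q where q: "q < length (dict_enum S)" "dict_enum S ! q = (\<lambda>i. 0)"
    using assms(2) enum(2) by (metis in_set_conv_nth)
  have "q = 0"
  proof (rule ccontr)
    assume "q \<noteq> 0"
    then have "less_fun (dict_enum S ! 0) (dict_enum S ! q)"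
      using q(1) by (intro sorted_wrt_nth_less[OF enum(1)]) auto
    then show False by (auto simp: q(2) less_fun_def)
  qed
  with q(2) show ?thesis by simp
qed

text \<open>Reordering the variables permutes the rows and changes only signs, so the lower bounds
  for all cyclic shifts concern one and the same integral.\<close>

lemma abs_vandermonde_permute:
  assumes "\<tau> permutes {0..<N}"
  shows "\<bar>vandermonde n' A N x\<bar> = (\<Prod>k=1..n'. \<bar>Determinant.det
    (Matrix.mat N N (\<lambda>(r, m). monomial (x (\<tau> r)) (dict_enum (slice A k) ! m)))\<bar>)"
  unfolding vandermonde_def abs_prod
proof (intro prod.cong refl)
  fix k
  let ?A = "Matrix.mat N N (\<lambda>(r, m). monomial (x r) (dict_enum (slice A k) ! m))"
  have "Matrix.mat N N (\<lambda>(r, m). ?A $$ (\<tau> r, m))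
    = Matrix.mat N N (\<lambda>(r, m). monomial (x (\<tau> r)) (dict_enum (slice A k) ! m))"
    using permutes_in_image[OF assms] by (intro cong_mat) auto
  then have "Determinant.det (Matrix.mat N N (\<lambda>(r, m). monomial (x (\<tau> r)) (dict_enum (slice A k) ! m)))
    = signof \<tau> * Determinant.det ?A"
    using det_permute_rows[of ?A N \<tau>] assms by simp
  moreover have "\<bar>signof \<tau> :: real\<bar> = 1"
    using signof_pm_one[of \<tau>, where ?'a = real] by auto
  ultimately show "\<bar>vandermonde_factor A N k x\<bar> = \<bar>Determinant.det
    (Matrix.mat N N (\<lambda>(r, m). monomial (x (\<tau> r)) (dict_enum (slice A k) ! m)))\<bar>"
    by (simp add: vandermonde_factor_def abs_mult)
qed

text \<open>The identity outside the range makes this a permutation in the sense of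
  \<open>permutes\<close>.\<close>

definition cyclic_shift :: "nat \<Rightarrow> nat \<Rightarrow> nat \<Rightarrow> nat" where
  "cyclic_shift N s r = (if r < N then (r + s) mod N else r)"

lemma inj_on_add_mod: "inj_on (\<lambda>r. (r + s) mod N) {..<N :: nat}"
proof -
  have "q = r" if "q \<le> r" "r < N" "(q + s) mod N = (r + s) mod N" for q r
  proof -
    have "N dvd r + s - (q + s)"
      using that by (subst mod_eq_dvd_iff_nat[symmetric]) auto
    then have "N dvd r - q" by simp
    moreover have "r - q < N" using that(2) by simp
    ultimately have "r - q = 0"
      using nat_dvd_not_less by blast
    with that(1) show ?thesis by simp
  qed
  note * = this
  show ?thesis
  proof (rule inj_onI)
    fix q r assume "q \<in> {..<N}" "r \<in> {..<N}" and eq: "(q + s) mod N = (r + s) mod N"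
    then have "q < N" "r < N" by auto
    then show "q = r"
      using *[of q r, OF _ _ eq] *[of r q, OF _ _ eq[symmetric]] by (cases "q \<le> r") auto
  qed
qed

lemma bij_betw_add_mod: "bij_betw (\<lambda>r. (r + s) mod N) {..<N :: nat} {..<N}"
proof (rule bij_betw_imageI[OF inj_on_add_mod])
  show "(\<lambda>r. (r + s) mod N) ` {..<N} = {..<N}"
    by (rule endo_inj_surj[OF _ _ inj_on_add_mod]) auto
qed

lemma cyclic_shift_permutes: "cyclic_shift N s permutes {0..<N}"
proof (rule bij_imp_permutes)
  have "bij_betw (cyclic_shift N s) {..<N} {..<N}"
    using bij_betw_add_mod[of s N]
    by (subst bij_betw_cong[where g = "\<lambda>r. (r + s) mod N"]) (auto simp: cyclic_shift_def)
  then show "bij_betw (cyclic_shift N s) {0..<N} {0..<N}"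
    by (simp add: atLeast0LessThan)
qed (simp add: cyclic_shift_def)

text \<open>The shifts form a Latin square: for fixed \<open>r\<close>, the value at
  \<open>r\<close> runs through every index exactly once as \<open>s\<close> varies.\<close>

lemma prod_cyclic_shift:
  fixes F :: "nat \<Rightarrow> nat \<Rightarrow> 'a::comm_monoid_mult"
  shows "(\<Prod>s<N. \<Prod>r<N. F r (cyclic_shift N s r)) = (\<Prod>r<N. \<Prod>j<N. F r j)"
proof -
  have "(\<Prod>s<N. F r (cyclic_shift N s r)) = (\<Prod>j<N. F r j)" if "r < N" for r
  proof -
    have "(\<Prod>s<N. F r (cyclic_shift N s r)) = (\<Prod>s<N. F r ((s + r) mod N))"
      by (rule prod.cong[OF refl]) (simp add: cyclic_shift_def that add.commute)
    also have "\<dots> = (\<Prod>j<N. F r j)"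
      by (rule prod.reindex_bij_betw[OF bij_betw_add_mod[of r N], of "F r"])
    finally show ?thesis .
  qed
  then have "(\<Prod>r<N. \<Prod>s<N. F r (cyclic_shift N s r)) = (\<Prod>r<N. \<Prod>j<N. F r j)"
    by simp
  moreover have "(\<Prod>s<N. \<Prod>r<N. F r (cyclic_shift N s r)) = (\<Prod>r<N. \<Prod>s<N. F r (cyclic_shift N s r))"
    by (rule prod.swap)
  ultimately show ?thesis by (rule trans[rotated])
qed

theorem theorem3:
  fixes A :: "(('n::{finite,linorder}) multiindex \<times> nat) set"
    and n' d N w :: nat and p :: real
  assumes "n' > 0" and "d > 0"
    and "A \<subseteq> multiindices d \<times> {1..n'}"
    and "admissible n' A N w"
    and "p = real N / (real N + real w)"
  shows "p < 1 \<and>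
    (\<exists>c::real. c > 0 \<and>
      (\<forall>f :: nat \<Rightarrow> real ^ 'n::{finite,linorder} \<Rightarrow> complex.
        (\<forall>j<N. f j \<in> borel_measurable lebesgue) \<longrightarrow>
        (\<integral>\<^sup>+ x. ennreal (\<bar>vandermonde n' A N x\<bar> * (\<Prod>j<N. norm (f j (x j))))
            \<partial>(\<Pi>\<^sub>M j\<in>{..<N}. lebesgue))
          \<ge> ennreal c * (\<Prod>j<N. lp_norm p (f j))))"
proof -
  define K where "K = {1..n'}"
  define \<alpha> where "\<alpha> k m = dict_enum (slice A k) ! m" for k m
  define \<beta> where "\<beta> r i = (\<Sum>k\<in>K. \<alpha> k r i)" for r i
  have adm: "\<And>k. k \<in> K \<Longrightarrow> card (slice A k) = N" "\<And>i. (\<Sum>k\<in>K. \<Sum>\<alpha>\<in>slice A k. \<alpha> i) = w"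
    "\<And>k. k \<in> K \<Longrightarrow> (\<lambda>i. 0) \<in> slice A k"
    and span: "span ((\<lambda>j. \<chi> i. real (\<beta> j i)) ` {..<N}) = UNIV"
    using assms(4) by (simp_all add: admissible_def K_def \<beta>_def \<alpha>_def)
  \<comment> \<open>Spanning a nonzero space requires a nonzero vector. Applied to the
    \<open>\<beta> j\<close>, this excludes both N = 0 and w = 0.\<close>
  have nontrivial: "\<exists>v \<in> B. v \<noteq> 0" if "span B = UNIV" for B :: "(real ^ 'n::{finite,linorder}) set"
  proof (rule ccontr)
    assume "\<not> (\<exists>v\<in>B. v \<noteq> 0)"
    then have "span B \<subseteq> {0}"
      by (intro span_minimal) auto
    with that have "axis undefined 1 = (0 :: real ^ 'n::{finite,linorder})"
      by blast
    then show False by (simp add: axis_eq_0_iff)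
  qed
  obtain j0 where j0: "j0 < N" "(\<chi> i. real (\<beta> j0 i)) \<noteq> 0"
    using nontrivial[OF span] by auto
  then have N: "N > 0" by simp
  \<comment> \<open>An infinite set has \<open>card\<close> 0, so positive cardinality gives
    finiteness.\<close>
  have fin: "finite (slice A k)" if "k \<in> K" for k
    using adm(1)[OF that] N by (metis card.infinite less_numeral_extra(3))
  have balance: "(\<Sum>j<N. \<beta> j i) = w" for i
  proof -
    have "(\<Sum>j<N. \<beta> j i) = (\<Sum>k\<in>K. \<Sum>j<N. \<alpha> k j i)"
      unfolding \<beta>_def by (rule sum.swap)
    also have "\<dots> = (\<Sum>k\<in>K. \<Sum>\<alpha>\<in>slice A k. \<alpha> i)"
      unfolding \<alpha>_def using sum_nth_dict_enum[OF fin, where F = "\<lambda>\<alpha>. \<alpha> i"] adm(1)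
      by (intro sum.cong) auto
    finally show ?thesis using adm(2) by simp
  qed
  have \<beta>0: "\<beta> 0 = (\<lambda>_. 0)"
    unfolding \<beta>_def \<alpha>_def using dict_enum_nth_0[OF fin adm(3)] by auto
  have less: "less_fun (\<alpha> k l) (\<alpha> k m)" if "k \<in> K" "l < m" "m < N" for k l m
    using that dict_enum(3)[OF fin[OF that(1)]] adm(1)[OF that(1)]
    unfolding \<alpha>_def by (intro sorted_wrt_nth_less[OF dict_enum(1)[OF fin[OF that(1)]]]) auto
  \<comment> \<open>If w were 0, balance would make every \<open>\<beta> j\<close> zero, against the
    choice of \<open>j0\<close>. This is what makes \<open>p\<close> strictly less than 1.\<close>
  have w: "w > 0"
  proof (rule ccontr)
    assume "\<not> w > 0"
    then have "\<beta> j0 i = 0" for i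
      using balance[of i] j0(1) by simp
    then have "(\<chi> i. real (\<beta> j0 i)) = 0" by (simp add: Finite_Cartesian_Product.vec_eq_iff)
    with j0(2) show False by contradiction
  qed
  have p: "0 < p" "p < 1" using N w by (simp_all add: assms(5))
  define \<sigma> where "\<sigma> = (real N + real w) / real N"
  have \<sigma>: "\<sigma> = 1 / p" "\<sigma> \<ge> 0" using N by (simp_all add: \<sigma>_def assms(5))
  define \<psi> where "\<psi> = ennreal_powr \<sigma>"
  let ?is = "sorted_list_of_set (UNIV :: 'n set)"
  obtain C where C: "C > 0" "\<And>h. h \<in> borel_measurable (lborel_PiM UNIV) \<Longrightarrow>
    (\<integral>\<^sup>+z. h z \<partial>lborel_PiM UNIV) ^ (N + w) \<le> ennreal C * (\<Prod>j<N. tower_sup (\<beta> j) ?is \<psi> h)"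
    using nn_integral_power_le_prod_tower_sup[of N ?is \<beta> w, OF N _ _ \<beta>0 span balance]
    unfolding \<psi>_def \<sigma>_def by auto
  define \<kappa> where "\<kappa> r = (\<Prod>i\<in>UNIV. sublevel_const (\<beta> r i))" for r
  have \<kappa>: "\<kappa> r > 0" for r
    unfolding \<kappa>_def by (intro prod_pos) (simp add: sublevel_const_pos)
  define \<kappa>' where "\<kappa>' = (\<Prod>r<N. \<kappa> r)"
  have \<kappa>': "\<kappa>' > 0" unfolding \<kappa>'_def by (intro prod_pos) (simp add: \<kappa>)
  \<comment> \<open>The constant: each shift contributes \<kappa>' from the sublevel estimates, and
    each function costs one factor \<open>C\<close> in the norm bound. After multiplying over N
    shifts and N functions both appear to the power N, which the final root removes.\<close>
  have "ennreal (\<kappa>' / C) * (\<Prod>j<N. lp_norm p (f j))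
    \<le> (\<integral>\<^sup>+ x. ennreal (\<bar>vandermonde n' A N x\<bar> * (\<Prod>j<N. norm (f j (x j)))) \<partial>(\<Pi>\<^sub>M j\<in>{..<N}. lebesgue))"
    if f: "\<And>j. j < N \<Longrightarrow> f j \<in> borel_measurable lebesgue"
    for f :: "nat \<Rightarrow> real ^ 'n::{finite,linorder} \<Rightarrow> complex"
  proof -
    have "\<forall>j. \<exists>g. g \<in> borel_measurable borel \<and> (\<forall>x. 0 \<le> g x) \<and>
      (j < N \<longrightarrow> (\<forall>x. g x \<le> norm (f j x)) \<and> (AE x in lborel. g x = norm (f j x)))"
    proof
      fix j
      show "\<exists>g. g \<in> borel_measurable borel \<and> (\<forall>x. 0 \<le> g x) \<and>
        (j < N \<longrightarrow> (\<forall>x. g x \<le> norm (f j x)) \<and> (AE x in lborel. g x = norm (f j x)))"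
      proof (cases "j < N")
        case True
        then show ?thesis
          using lebesgue_measurable_borel_minorant[OF f[OF True]] by blast
      qed (intro exI[of _ "\<lambda>_. 0"], simp)
    qed
    from choice[OF this] obtain g
      where g: "\<And>j. g j \<in> borel_measurable borel" "\<And>j x. 0 \<le> g j x"
        "\<And>j x. j < N \<Longrightarrow> g j x \<le> norm (f j x)" "\<And>j. j < N \<Longrightarrow> AE x in lborel. g j x = norm (f j x)"
      by blast
    \<comment> \<open>With the p-th power as the base function, the norm is expressed by the plain
      integral of \<open>h j\<close>, and the choice \<sigma> = 1 / p in \<psi> turns
      \<open>h j\<close> back into \<open>g j\<close> inside the Vandermonde integral.\<close>
    define h where "h j y = ennreal (g j y powr p)" for j y
    have h: "h j \<in> borel_measurable borel" for j
      unfolding h_def using g(1) by measurable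
    have \<psi>h: "\<psi> (h j y) = ennreal (g j y)" for j y
      using p(1) g(2)[of j y]
      by (simp add: h_def \<psi>_def ennreal_powr_ennreal powr_powr \<sigma>(1))
    define \<Phi> where "\<Phi> r j = tower_sup (\<beta> r) ?is \<psi> (\<lambda>z. h j (\<chi> i. z i))" for r j
    define Q where "Q = (\<integral>\<^sup>+ x. ennreal \<bar>vandermonde n' A N x\<bar> * (\<Prod>j<N. ennreal (g j (x j))) \<partial>(\<Pi>\<^sub>M j\<in>{..<N}. lebesgue))"
    have Q: "(\<Prod>r<N. ennreal (\<kappa> r) * \<Phi> r (cyclic_shift N s r)) \<le> Q" for s
    proof -
      let ?\<tau> = "cyclic_shift N s"
      note perm = cyclic_shift_permutes[of N s]
      have inj: "inj_on ?\<tau> {..<N}" and img: "?\<tau> ` {..<N} = {..<N}"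
        using permutes_inj_on[OF perm] permutes_image[OF perm] by (auto simp: atLeast0LessThan)
      show ?thesis
        using nn_integral_det_prod_ge[of K N \<alpha> h \<psi> ?\<tau>, OF _ less h _ _ inj]
        unfolding img Q_def abs_vandermonde_permute[OF perm] \<psi>h \<kappa>_def \<Phi>_def \<beta>_def[abs_def] \<alpha>_def[symmetric] K_def[symmetric]
        by (simp add: \<psi>_def mono_ennreal_powr \<sigma>(2) ennreal_powr_measurable K_def)
    qed
    have lp: "lp_norm p (f j) ^ N \<le> ennreal C * (\<Prod>r<N. \<Phi> r j)" if j: "j < N" for j
    proof -
      have "lp_norm p (f j) ^ N \<le> (\<integral>\<^sup>+t. ennreal (norm (f j t) powr p) \<partial>lebesgue) ^ (N + w)"
        unfolding assms(5) by (rule lp_norm_power_le[OF N])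
      also have "(\<integral>\<^sup>+t. ennreal (norm (f j t) powr p) \<partial>lebesgue) = (\<integral>\<^sup>+t. h j t \<partial>lborel)"
        unfolding nn_integral_completion h_def
        using g(4)[OF j] by (intro nn_integral_cong_AE) (auto elim!: eventually_mono)
      also have "\<dots> = (\<integral>\<^sup>+z. h j (\<chi> i. z i) \<partial>lborel_PiM UNIV)"
        by (rule nn_integral_lborel_vec[OF h])
      also have "\<dots> ^ (N + w) \<le> ennreal C * (\<Prod>r<N. \<Phi> r j)"
        unfolding \<Phi>_def by (intro C(2) measurable_compose[OF vec_lambda_measurable h])
      finally show ?thesis .
    qed
    \<comment> \<open>The N-th power makes room for all N shifts: the bound on norms groups the
      factors \<open>\<Phi> r j\<close> by function, the bound on \<open>Q\<close> groups the same
      factors by shift.\<close>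
    have "(ennreal \<kappa>' * (\<Prod>j<N. lp_norm p (f j))) ^ N = ennreal \<kappa>' ^ N * (\<Prod>j<N. lp_norm p (f j) ^ N)"
      by (simp add: power_mult_distrib prod_power_distrib)
    also have "\<dots> \<le> ennreal \<kappa>' ^ N * (\<Prod>j<N. ennreal C * (\<Prod>r<N. \<Phi> r j))"
      using lp by (intro mult_left_mono prod_mono_ennreal) auto
    also have "\<dots> = ennreal C ^ N * (\<Prod>r<N. \<Prod>j<N. ennreal (\<kappa> r) * \<Phi> r j)"
    proof -
      have "ennreal \<kappa>' ^ N = (\<Prod>r<N. \<Prod>j<N. ennreal (\<kappa> r))"
        using \<kappa> by (simp add: \<kappa>'_def prod_ennreal[symmetric] less_imp_le prod_power_distrib)
      moreover have "(\<Prod>j<N. \<Prod>r<N. \<Phi> r j) = (\<Prod>r<N. \<Prod>j<N. \<Phi> r j)"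
        by (rule prod.swap)
      ultimately show ?thesis
        by (simp only: prod.distrib prod_constant card_lessThan mult_ac)
    qed
    also have "\<dots> = ennreal C ^ N * (\<Prod>s<N. \<Prod>r<N. ennreal (\<kappa> r) * \<Phi> r (cyclic_shift N s r))"
      by (subst prod_cyclic_shift) simp
    also have "\<dots> \<le> ennreal C ^ N * (\<Prod>s<N. Q)"
      using Q by (intro mult_left_mono prod_mono_ennreal) auto
    also have "\<dots> = (ennreal C * Q) ^ N"
      by (simp add: power_mult_distrib)
    finally have "ennreal \<kappa>' * (\<Prod>j<N. lp_norm p (f j)) \<le> ennreal C * Q"
      using N by (rule ennreal_power_le_cancel)
    then have "ennreal (1 / C) * (ennreal \<kappa>' * (\<Prod>j<N. lp_norm p (f j))) \<le> ennreal (1 / C) * (ennreal C * Q)"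
      by (rule mult_left_mono) simp
    moreover have "ennreal (1 / C) * ennreal \<kappa>' = ennreal (\<kappa>' / C)" "ennreal (1 / C) * ennreal C = 1"
      using C(1) \<kappa>' by (simp_all add: ennreal_mult'[symmetric])
    ultimately have "ennreal (\<kappa>' / C) * (\<Prod>j<N. lp_norm p (f j)) \<le> Q"
      by (simp only: mult.assoc[symmetric] mult_1_left)
    also have "Q \<le> (\<integral>\<^sup>+ x. ennreal (\<bar>vandermonde n' A N x\<bar> * (\<Prod>j<N. norm (f j (x j)))) \<partial>(\<Pi>\<^sub>M j\<in>{..<N}. lebesgue))"
      unfolding Q_def
    proof (intro nn_integral_mono)
      fix x
      have "(\<Prod>j<N. g j (x j)) \<le> (\<Prod>j<N. norm (f j (x j)))"
        using g(2,3) by (intro prod_mono) auto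
      then show "ennreal \<bar>vandermonde n' A N x\<bar> * (\<Prod>j<N. ennreal (g j (x j)))
        \<le> ennreal (\<bar>vandermonde n' A N x\<bar> * (\<Prod>j<N. norm (f j (x j))))"
        using g(2) by (simp add: prod_ennreal ennreal_mult'[symmetric] ennreal_leI mult_left_mono)
    qed
    finally show ?thesis .
  qed
  moreover have "\<kappa>' / C > 0" using \<kappa>' C(1) by simp
  ultimately show ?thesis
    using p(2) by (intro conjI exI[of _ "\<kappa>' / C"] allI impI) auto
qed

end
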